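(* Over $\mathrm{HA}^\omega+\mathrm{BI}$, the dependent explicitly controlled product of quantifiers $\mathsf{EPQ}$ is $T$-definable from Spector's general bar recursion $\mathsf{BR}$; that is, $\mathsf{BR}\geq_T\mathsf{EPQ}$.
   Context: Types and systems. Finite types are generated from $\mathbb{B}$ (booleans) and $\mathbb{N}$ by $X\times Y$, $X\to Y$ and $X^*$ (finite sequences). For a sequence of types $(X_i)_{i\in\mathbb{N}}$, $\Pi_i X_i$ is the type of infinite sequences whose $i$-th entry is in $X_i$ and $\Pi_{i<n}X_i$ the type of finite sequences of length $n$. (This is used for readability; one may take all $X_i$ equal to one type $X$, reading $\Pi_iX_i$ as $\mathbb{N}\to X$ and finite sequence types as $X^*$.) $\mathrm{HA}^\omega$ is Heyting arithmetic in all finite types with fully extensional equality (Troelstra's E-$\mathrm{HA}^\omega$); system $T$ is its quantifier-free fragment (Gödel's primitive recursive functionals). $\mathbf{0}$ denotes the canonical zero object of each type (the zero sequence for sequence types). Notation. $*$ is concatenation; $|s|$ is the length of $s$; $q_s(\alpha)=q(s*\alpha)$, $q_x=q_{\langle x\rangle}$. $K_RX=(X\to R)\to R$. $T$-definability. A functional is specified by a defining equation (for each choice of type parameters). $G$ is $T$-definable from $F$ over a theory $\mathcal{S}$ (written $F\ge_T G$) if for each choice of types for $G$ there are a choice of types for $F$ and a term $s$ of system $T$ such that $s(F)$ satisfies the defining equation of $G$, provably in $\mathcal{S}$ together with the defining equation of $F$. In both definitions $\phi\colon\Pi_k(\Pi_{i<k}X_i\to K_RX_k)$, so $\phi_s\colon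 K_RX_{|s|}$ for $s\colon\Pi_{i<|s|}X_i$. $\mathsf{BR}$. For $q\colon\Pi_iX_i\to R$, $\omega\colon\Pi_iX_i\to\mathbb{N}$, the value $\mathsf{BR}^\omega_s(\phi)(q)\colon R$ is specified by: $\mathsf{BR}^\omega_s(\phi)(q)=q_s(\mathbf{0})$ if $\omega_s(\mathbf{0})<|s|$, and otherwise $\mathsf{BR}^\omega_s(\phi)(q)=\phi_s(\lambda x^{X_{|s|}}.\,\mathsf{BR}^\omega_{s*x}(\phi)(q))$. $\mathsf{EPQ}$. For $q\colon\Pi_iX_{|s|+i}\to R$, $\ell\colon R\to\mathbb{N}$, the value $\mathsf{EPQ}^\ell_s(\phi)(q)\colon R$ is specified by: $\mathsf{EPQ}^\ell_s(\phi)(q)=q(\mathbf{0})$ if $\ell(q(\mathbf{0}))<|s|$, and otherwise $\mathsf{EPQ}^\ell_s(\phi)(q)=\phi_s(\lambda x^{X_{|s|}}.\,\mathsf{EPQ}^\ell_{s*x}(\phi)(q_x))$. $\mathrm{BI}$ (relativised bar induction) is the scheme, for arbitrary predicates $S,P$ on finite sequences: if $S(\langle\rangle)$, and for every infinite $\alpha$ with $S([\alpha](n))$ for all $n$ there is $n$ with $P([\alpha](n))$, and for all $s$ with $S(s)$: $\forall x[S(s*x)\to P(s*x)]\to P(s)$; then $P(\langle\rangle)$. Here $[\alpha](n)=\langle\alpha(0),\dots,\alpha(n-1)\rangle$. *)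

theory Defs
  imports Main
begin

section \<open>Finite types and the terms of system T\<close>

datatype ty =
    Bool
  | Nat
  | Prod ty ty
  | Fun ty ty  (infixr "\<rightarrowtail>" 70)
  | Seq ty

text \<open>Constants carry the type parameters at which they are used. Finite sequences are generated by
  the empty sequence and by appending one element at the end, \<open>s, x \<mapsto> s * x\<close>.\<close>

datatype con =
    TrueC | FalseC | CondC ty
  | ZeroC | SucC | RecC ty
  | PairC ty ty | FstC ty ty | SndC ty ty
  | NilC ty | SnocC ty | SRecC ty ty

primrec con_ty :: "con \<Rightarrow> ty" where
  "con_ty TrueC = Bool"
| "con_ty FalseC = Bool"
| "con_ty (CondC T) = Bool \<rightarrowtail> T \<rightarrowtail> T \<rightarrowtail> T"
| "con_ty ZeroC = Nat"
| "con_ty SucC = Nat \<rightarrowtail> Nat"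
| "con_ty (RecC T) = T \<rightarrowtail> (Nat \<rightarrowtail> T \<rightarrowtail> T) \<rightarrowtail> Nat \<rightarrowtail> T"
| "con_ty (PairC T U) = T \<rightarrowtail> U \<rightarrowtail> Prod T U"
| "con_ty (FstC T U) = Prod T U \<rightarrowtail> T"
| "con_ty (SndC T U) = Prod T U \<rightarrowtail> U"
| "con_ty (NilC X) = Seq X"
| "con_ty (SnocC X) = Seq X \<rightarrowtail> X \<rightarrowtail> Seq X"
| "con_ty (SRecC X T) = T \<rightarrowtail> (Seq X \<rightarrowtail> X \<rightarrowtail> T \<rightarrowtail> T) \<rightarrowtail> Seq X \<rightarrowtail> T"

text \<open>Variables are de Bruijn indices; they are bound by \<open>Lam\<close> and by the quantifiers below.\<close>

datatype tm =
    Var nat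
  | Con con
  | App tm tm  (infixl "\<cdot>" 200)
  | Lam ty tm

inductive has_type :: "ty list \<Rightarrow> tm \<Rightarrow> ty \<Rightarrow> bool"  ("_ \<turnstile> _ \<Ztypecolon> _" [60, 60, 60] 60) where
  ty_Var: "i < length \<Gamma> \<Longrightarrow> \<Gamma> \<turnstile> Var i \<Ztypecolon> (\<Gamma> ! i)"
| ty_Con: "\<Gamma> \<turnstile> Con c \<Ztypecolon> con_ty c"
| ty_App: "\<Gamma> \<turnstile> t \<Ztypecolon> (T \<rightarrowtail> U) \<Longrightarrow> \<Gamma> \<turnstile> u \<Ztypecolon> T \<Longrightarrow> \<Gamma> \<turnstile> t \<cdot> u \<Ztypecolon> U"
| ty_Lam: "T # \<Gamma> \<turnstile> t \<Ztypecolon> U \<Longrightarrow> \<Gamma> \<turnstile> Lam T t \<Ztypecolon> (T \<rightarrowtail> U)"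

definition ren_up :: "(nat \<Rightarrow> nat) \<Rightarrow> nat \<Rightarrow> nat" where
  "ren_up r = case_nat 0 (Suc \<circ> r)"

primrec ren_tm :: "(nat \<Rightarrow> nat) \<Rightarrow> tm \<Rightarrow> tm" where
  "ren_tm r (Var i) = Var (r i)"
| "ren_tm r (Con c) = Con c"
| "ren_tm r (t \<cdot> u) = ren_tm r t \<cdot> ren_tm r u"
| "ren_tm r (Lam T t) = Lam T (ren_tm (ren_up r) t)"

text \<open>\<open>lift k t\<close> is \<open>t\<close> placed under \<open>k\<close> further binders.\<close>

definition lift :: "nat \<Rightarrow> tm \<Rightarrow> tm" where
  "lift k = ren_tm (\<lambda>i. i + k)"

definition sub_up :: "(nat \<Rightarrow> tm) \<Rightarrow> nat \<Rightarrow> tm" where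
  "sub_up \<sigma> = case_nat (Var 0) (lift 1 \<circ> \<sigma>)"

primrec sub_tm :: "(nat \<Rightarrow> tm) \<Rightarrow> tm \<Rightarrow> tm" where
  "sub_tm \<sigma> (Var i) = \<sigma> i"
| "sub_tm \<sigma> (Con c) = Con c"
| "sub_tm \<sigma> (t \<cdot> u) = sub_tm \<sigma> t \<cdot> sub_tm \<sigma> u"
| "sub_tm \<sigma> (Lam T t) = Lam T (sub_tm (sub_up \<sigma>) t)"


section \<open>Formulas and intuitionistic provability\<close>

datatype fm =
    Eq ty tm tm
  | Bot
  | And fm fm
  | Or fm fm
  | Imp fm fm  (infixr "\<rightarrow>\<^sub>f" 55)
  | All ty fm
  | Ex ty fm

primrec wf_fm :: "ty list \<Rightarrow> fm \<Rightarrow> bool" where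
  "wf_fm \<Gamma> (Eq T t u) \<longleftrightarrow> (\<Gamma> \<turnstile> t \<Ztypecolon> T) \<and> (\<Gamma> \<turnstile> u \<Ztypecolon> T)"
| "wf_fm \<Gamma> Bot \<longleftrightarrow> True"
| "wf_fm \<Gamma> (And A B) \<longleftrightarrow> wf_fm \<Gamma> A \<and> wf_fm \<Gamma> B"
| "wf_fm \<Gamma> (Or A B) \<longleftrightarrow> wf_fm \<Gamma> A \<and> wf_fm \<Gamma> B"
| "wf_fm \<Gamma> (A \<rightarrow>\<^sub>f B) \<longleftrightarrow> wf_fm \<Gamma> A \<and> wf_fm \<Gamma> B"
| "wf_fm \<Gamma> (All T A) \<longleftrightarrow> wf_fm (T # \<Gamma>) A"
| "wf_fm \<Gamma> (Ex T A) \<longleftrightarrow> wf_fm (T # \<Gamma>) A"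

primrec sub_fm :: "(nat \<Rightarrow> tm) \<Rightarrow> fm \<Rightarrow> fm" where
  "sub_fm \<sigma> (Eq T t u) = Eq T (sub_tm \<sigma> t) (sub_tm \<sigma> u)"
| "sub_fm \<sigma> Bot = Bot"
| "sub_fm \<sigma> (And A B) = And (sub_fm \<sigma> A) (sub_fm \<sigma> B)"
| "sub_fm \<sigma> (Or A B) = Or (sub_fm \<sigma> A) (sub_fm \<sigma> B)"
| "sub_fm \<sigma> (A \<rightarrow>\<^sub>f B) = (sub_fm \<sigma> A \<rightarrow>\<^sub>f sub_fm \<sigma> B)"
| "sub_fm \<sigma> (All T A) = All T (sub_fm (sub_up \<sigma>) A)"
| "sub_fm \<sigma> (Ex T A) = Ex T (sub_fm (sub_up \<sigma>) A)"

definition lift_fm :: "fm \<Rightarrow> fm" where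
  "lift_fm = sub_fm (\<lambda>i. Var (Suc i))"

text \<open>A formula \<open>A\<close> over \<open>X # \<Gamma>\<close> is a predicate on \<open>X\<close>, with index 0 as its argument and parameters
  from \<open>\<Gamma>\<close>. \<open>inst k A t\<close> is this predicate at an argument \<open>t\<close> that lives under \<open>k\<close> further binders.\<close>

definition inst :: "nat \<Rightarrow> fm \<Rightarrow> tm \<Rightarrow> fm" where
  "inst k A t = sub_fm (case_nat t (\<lambda>i. Var (i + k))) A"

text \<open>A theory is a set of axioms in context: in \<open>(\<Gamma>, A)\<close> the free variables of \<open>A\<close> have the types
  \<open>\<Gamma>\<close>. The axiom schemes below are stated for every context \<open>\<Gamma>\<close>, hence may contain parameters.
  \<open>prv S \<Gamma> H A\<close> says that \<open>S\<close> proves \<open>A\<close> from the hypotheses \<open>H\<close>, where the free variables have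
  types \<open>\<Gamma>\<close>: natural deduction for many-sorted intuitionistic logic with equality at every type.\<close>

type_synonym thry = "(ty list \<times> fm) set"

inductive prv :: "thry \<Rightarrow> ty list \<Rightarrow> fm set \<Rightarrow> fm \<Rightarrow> bool" for S :: thry where
  Ax: "(\<Gamma>, A) \<in> S \<Longrightarrow> prv S \<Gamma> H A"
| Hyp: "A \<in> H \<Longrightarrow> wf_fm \<Gamma> A \<Longrightarrow> prv S \<Gamma> H A"
| BotE: "prv S \<Gamma> H Bot \<Longrightarrow> wf_fm \<Gamma> A \<Longrightarrow> prv S \<Gamma> H A"
| AndI: "prv S \<Gamma> H A \<Longrightarrow> prv S \<Gamma> H B \<Longrightarrow> prv S \<Gamma> H (And A B)"
| AndE1: "prv S \<Gamma> H (And A B) \<Longrightarrow> prv S \<Gamma> H A"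
| AndE2: "prv S \<Gamma> H (And A B) \<Longrightarrow> prv S \<Gamma> H B"
| OrI1: "prv S \<Gamma> H A \<Longrightarrow> wf_fm \<Gamma> B \<Longrightarrow> prv S \<Gamma> H (Or A B)"
| OrI2: "wf_fm \<Gamma> A \<Longrightarrow> prv S \<Gamma> H B \<Longrightarrow> prv S \<Gamma> H (Or A B)"
| OrE: "prv S \<Gamma> H (Or A B) \<Longrightarrow> prv S \<Gamma> (insert A H) C \<Longrightarrow> prv S \<Gamma> (insert B H) C
    \<Longrightarrow> prv S \<Gamma> H C"
| ImpI: "wf_fm \<Gamma> A \<Longrightarrow> prv S \<Gamma> (insert A H) B \<Longrightarrow> prv S \<Gamma> H (A \<rightarrow>\<^sub>f B)"
| ImpE: "prv S \<Gamma> H (A \<rightarrow>\<^sub>f B) \<Longrightarrow> prv S \<Gamma> H A \<Longrightarrow> prv S \<Gamma> H B"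
| AllI: "prv S (T # \<Gamma>) (lift_fm ` H) A \<Longrightarrow> prv S \<Gamma> H (All T A)"
| AllE: "prv S \<Gamma> H (All T A) \<Longrightarrow> \<Gamma> \<turnstile> t \<Ztypecolon> T \<Longrightarrow> prv S \<Gamma> H (inst 0 A t)"
| ExI: "wf_fm (T # \<Gamma>) A \<Longrightarrow> \<Gamma> \<turnstile> t \<Ztypecolon> T \<Longrightarrow> prv S \<Gamma> H (inst 0 A t) \<Longrightarrow> prv S \<Gamma> H (Ex T A)"
| ExE: "prv S \<Gamma> H (Ex T A) \<Longrightarrow> wf_fm \<Gamma> C
    \<Longrightarrow> prv S (T # \<Gamma>) (insert A (lift_fm ` H)) (lift_fm C) \<Longrightarrow> prv S \<Gamma> H C"
| EqI: "\<Gamma> \<turnstile> t \<Ztypecolon> T \<Longrightarrow> prv S \<Gamma> H (Eq T t t)"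
| EqE: "wf_fm (T # \<Gamma>) A \<Longrightarrow> prv S \<Gamma> H (Eq T t u) \<Longrightarrow> prv S \<Gamma> H (inst 0 A t)
    \<Longrightarrow> prv S \<Gamma> H (inst 0 A u)"


section \<open>Heyting arithmetic in all finite types\<close>

inductive_set HA_omega :: thry where
  beta: "T # \<Gamma> \<turnstile> t \<Ztypecolon> U \<Longrightarrow> \<Gamma> \<turnstile> u \<Ztypecolon> T
    \<Longrightarrow> (\<Gamma>, Eq U (Lam T t \<cdot> u) (sub_tm (case_nat u Var) t)) \<in> HA_omega"
| ext: "\<Gamma> \<turnstile> f \<Ztypecolon> (T \<rightarrowtail> U) \<Longrightarrow> \<Gamma> \<turnstile> g \<Ztypecolon> (T \<rightarrowtail> U)
    \<Longrightarrow> (\<Gamma>, All T (Eq U (lift 1 f \<cdot> Var 0) (lift 1 g \<cdot> Var 0)) \<rightarrow>\<^sub>f Eq (T \<rightarrowtail> U) f g) \<in> HA_omega"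
| cond_true: "\<Gamma> \<turnstile> a \<Ztypecolon> T \<Longrightarrow> \<Gamma> \<turnstile> b \<Ztypecolon> T
    \<Longrightarrow> (\<Gamma>, Eq T (Con (CondC T) \<cdot> Con TrueC \<cdot> a \<cdot> b) a) \<in> HA_omega"
| cond_false: "\<Gamma> \<turnstile> a \<Ztypecolon> T \<Longrightarrow> \<Gamma> \<turnstile> b \<Ztypecolon> T
    \<Longrightarrow> (\<Gamma>, Eq T (Con (CondC T) \<cdot> Con FalseC \<cdot> a \<cdot> b) b) \<in> HA_omega"
| bool_induct: "wf_fm (Bool # \<Gamma>) A
    \<Longrightarrow> (\<Gamma>, inst 0 A (Con TrueC) \<rightarrow>\<^sub>f inst 0 A (Con FalseC) \<rightarrow>\<^sub>f All Bool A) \<in> HA_omega"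
| suc_not_zero: "\<Gamma> \<turnstile> n \<Ztypecolon> Nat
    \<Longrightarrow> (\<Gamma>, Eq Nat (Con SucC \<cdot> n) (Con ZeroC) \<rightarrow>\<^sub>f Bot) \<in> HA_omega"
| suc_inject: "\<Gamma> \<turnstile> m \<Ztypecolon> Nat \<Longrightarrow> \<Gamma> \<turnstile> n \<Ztypecolon> Nat
    \<Longrightarrow> (\<Gamma>, Eq Nat (Con SucC \<cdot> m) (Con SucC \<cdot> n) \<rightarrow>\<^sub>f Eq Nat m n) \<in> HA_omega"
| rec_zero: "\<Gamma> \<turnstile> a \<Ztypecolon> T \<Longrightarrow> \<Gamma> \<turnstile> f \<Ztypecolon> (Nat \<rightarrowtail> T \<rightarrowtail> T)
    \<Longrightarrow> (\<Gamma>, Eq T (Con (RecC T) \<cdot> a \<cdot> f \<cdot> Con ZeroC) a) \<in> HA_omega"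
| rec_suc: "\<Gamma> \<turnstile> a \<Ztypecolon> T \<Longrightarrow> \<Gamma> \<turnstile> f \<Ztypecolon> (Nat \<rightarrowtail> T \<rightarrowtail> T) \<Longrightarrow> \<Gamma> \<turnstile> n \<Ztypecolon> Nat
    \<Longrightarrow> (\<Gamma>, Eq T (Con (RecC T) \<cdot> a \<cdot> f \<cdot> (Con SucC \<cdot> n))
               (f \<cdot> n \<cdot> (Con (RecC T) \<cdot> a \<cdot> f \<cdot> n))) \<in> HA_omega"
| nat_induct: "wf_fm (Nat # \<Gamma>) A
    \<Longrightarrow> (\<Gamma>, inst 0 A (Con ZeroC) \<rightarrow>\<^sub>f All Nat (A \<rightarrow>\<^sub>f inst 1 A (Con SucC \<cdot> Var 0)) \<rightarrow>\<^sub>f All Nat A)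
        \<in> HA_omega"
| fst_pair: "\<Gamma> \<turnstile> a \<Ztypecolon> T \<Longrightarrow> \<Gamma> \<turnstile> b \<Ztypecolon> U
    \<Longrightarrow> (\<Gamma>, Eq T (Con (FstC T U) \<cdot> (Con (PairC T U) \<cdot> a \<cdot> b)) a) \<in> HA_omega"
| snd_pair: "\<Gamma> \<turnstile> a \<Ztypecolon> T \<Longrightarrow> \<Gamma> \<turnstile> b \<Ztypecolon> U
    \<Longrightarrow> (\<Gamma>, Eq U (Con (SndC T U) \<cdot> (Con (PairC T U) \<cdot> a \<cdot> b)) b) \<in> HA_omega"
| pair_surj: "\<Gamma> \<turnstile> p \<Ztypecolon> Prod T U
    \<Longrightarrow> (\<Gamma>, Eq (Prod T U) (Con (PairC T U) \<cdot> (Con (FstC T U) \<cdot> p) \<cdot> (Con (SndC T U) \<cdot> p)) p)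
        \<in> HA_omega"
| srec_nil: "\<Gamma> \<turnstile> a \<Ztypecolon> T \<Longrightarrow> \<Gamma> \<turnstile> f \<Ztypecolon> (Seq X \<rightarrowtail> X \<rightarrowtail> T \<rightarrowtail> T)
    \<Longrightarrow> (\<Gamma>, Eq T (Con (SRecC X T) \<cdot> a \<cdot> f \<cdot> Con (NilC X)) a) \<in> HA_omega"
| srec_snoc: "\<Gamma> \<turnstile> a \<Ztypecolon> T \<Longrightarrow> \<Gamma> \<turnstile> f \<Ztypecolon> (Seq X \<rightarrowtail> X \<rightarrowtail> T \<rightarrowtail> T) \<Longrightarrow> \<Gamma> \<turnstile> s \<Ztypecolon> Seq X \<Longrightarrow> \<Gamma> \<turnstile> x \<Ztypecolon> X
    \<Longrightarrow> (\<Gamma>, Eq T (Con (SRecC X T) \<cdot> a \<cdot> f \<cdot> (Con (SnocC X) \<cdot> s \<cdot> x))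
               (f \<cdot> s \<cdot> x \<cdot> (Con (SRecC X T) \<cdot> a \<cdot> f \<cdot> s))) \<in> HA_omega"
| seq_induct: "wf_fm (Seq X # \<Gamma>) A
    \<Longrightarrow> (\<Gamma>, inst 0 A (Con (NilC X))
           \<rightarrow>\<^sub>f All (Seq X) (All X (inst 2 A (Var 1) \<rightarrow>\<^sub>f inst 2 A (Con (SnocC X) \<cdot> Var 1 \<cdot> Var 0)))
           \<rightarrow>\<^sub>f All (Seq X) A) \<in> HA_omega"


section \<open>Operations on sequences and numbers\<close>

text \<open>The operations with suffix \<open>C\<close> are closed terms.\<close>

primrec zero :: "ty \<Rightarrow> tm" where
  "zero Bool = Con FalseC"
| "zero Nat = Con ZeroC"
| "zero (Prod T U) = Con (PairC T U) \<cdot> zero T \<cdot> zero U"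
| "zero (T \<rightarrowtail> U) = Lam T (zero U)"
| "zero (Seq X) = Con (NilC X)"

abbreviation snoc :: "ty \<Rightarrow> tm \<Rightarrow> tm \<Rightarrow> tm" where
  "snoc X s x \<equiv> Con (SnocC X) \<cdot> s \<cdot> x"

text \<open>\<open>pred 0 = 0\<close>, \<open>pred (Suc m) = m\<close>; \<open>a - 0 = a\<close>, \<open>a - Suc m = pred (a - m)\<close>;
  \<open>a < b\<close> is true iff \<open>b - a\<close> is a successor.\<close>

definition predC :: tm where
  "predC = Con (RecC Nat) \<cdot> Con ZeroC \<cdot> Lam Nat (Lam Nat (Var 1))"

definition minusC :: tm where
  "minusC = Lam Nat (Con (RecC Nat) \<cdot> Var 0 \<cdot> Lam Nat predC)"

definition lessC :: tm where
  "lessC = Lam Nat (Lam Nat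
     (Con (RecC Bool) \<cdot> Con FalseC \<cdot> Lam Nat (Lam Bool (Con TrueC)) \<cdot> (minusC \<cdot> Var 0 \<cdot> Var 1)))"

definition lenC :: "ty \<Rightarrow> tm" where
  "lenC X = Con (SRecC X Nat) \<cdot> Con ZeroC \<cdot> Lam (Seq X) (Lam X (Con SucC))"

text \<open>\<open>cons x \<alpha>\<close> is \<open>x\<close> at 0 and \<open>\<alpha> m\<close> at \<open>Suc m\<close>. Concatenation of a finite and an infinite sequence:
  \<open>cat \<langle>\<rangle> \<alpha> = \<alpha>\<close>, \<open>cat (s * x) \<alpha> = cat s (cons x \<alpha>)\<close>. Initial segments \<open>[\<alpha>](n)\<close>:
  \<open>init \<alpha> 0 = \<langle>\<rangle>\<close>, \<open>init \<alpha> (Suc m) = init \<alpha> m * \<alpha> m\<close>.\<close>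

definition consC :: "ty \<Rightarrow> tm" where
  "consC X = Lam X (Lam (Nat \<rightarrowtail> X) (Lam Nat
     (Con (RecC X) \<cdot> Var 2 \<cdot> Lam Nat (Lam X (Var 3 \<cdot> Var 1)) \<cdot> Var 0)))"

definition catC :: "ty \<Rightarrow> tm" where
  "catC X = Con (SRecC X ((Nat \<rightarrowtail> X) \<rightarrowtail> Nat \<rightarrowtail> X))
     \<cdot> Lam (Nat \<rightarrowtail> X) (Var 0)
     \<cdot> Lam (Seq X) (Lam X (Lam ((Nat \<rightarrowtail> X) \<rightarrowtail> Nat \<rightarrowtail> X) (Lam (Nat \<rightarrowtail> X)
          (Var 1 \<cdot> (consC X \<cdot> Var 2 \<cdot> Var 0)))))"

definition initC :: "ty \<Rightarrow> tm" where
  "initC X = Lam (Nat \<rightarrowtail> X)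
     (Con (RecC (Seq X)) \<cdot> Con (NilC X) \<cdot> Lam Nat (Lam (Seq X) (snoc X (Var 0) (Var 2 \<cdot> Var 1))))"

text \<open>\<open>sect X q s\<close> is \<open>q\<^sub>s = (\<lambda>\<alpha>. q (s * \<alpha>))\<close>.\<close>

definition sect :: "ty \<Rightarrow> tm \<Rightarrow> tm \<Rightarrow> tm" where
  "sect X q s = Lam (Nat \<rightarrowtail> X) (lift 1 q \<cdot> (catC X \<cdot> lift 1 s \<cdot> Var 0))"


section \<open>Relativised bar induction\<close>

inductive_set BI :: thry where
  bar_induct: "wf_fm (Seq X # \<Gamma>) S \<Longrightarrow> wf_fm (Seq X # \<Gamma>) P \<Longrightarrow>
    (\<Gamma>, inst 0 S (Con (NilC X))
        \<rightarrow>\<^sub>f All (Nat \<rightarrowtail> X)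
             (All Nat (inst 2 S (initC X \<cdot> Var 1 \<cdot> Var 0))
                \<rightarrow>\<^sub>f Ex Nat (inst 2 P (initC X \<cdot> Var 1 \<cdot> Var 0)))
        \<rightarrow>\<^sub>f All (Seq X)
             (S \<rightarrow>\<^sub>f All X (inst 2 S (snoc X (Var 1) (Var 0)) \<rightarrow>\<^sub>f inst 2 P (snoc X (Var 1) (Var 0)))
                \<rightarrow>\<^sub>f P)
        \<rightarrow>\<^sub>f inst 0 P (Con (NilC X))) \<in> BI"


section \<open>Definability in system T\<close>

text \<open>A functional is specified, for each choice \<open>p\<close> of type parameters, by its type and by the
  universal closure of its defining equation, a formula about the term that is to satisfy it.\<close>

record 'p functional =
  fn_type :: "'p \<Rightarrow> ty"
  fn_eqn :: "'p \<Rightarrow> tm \<Rightarrow> fm"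

text \<open>Over \<open>S\<close>, the functional \<open>G\<close> is definable in \<open>F\<close>. The functional \<open>F\<close> is the free variable
  \<open>Var 0\<close>, and \<open>s\<close> is a closed term.\<close>

definition T_definable :: "thry \<Rightarrow> 'p functional \<Rightarrow> 'q functional \<Rightarrow> bool" where
  "T_definable S F G \<longleftrightarrow>
     (\<forall>p. \<exists>p' s. [] \<turnstile> s \<Ztypecolon> (fn_type F p' \<rightarrowtail> fn_type G p) \<and>
        prv S [fn_type F p'] {fn_eqn F p' (Var 0)} (fn_eqn G p (s \<cdot> Var 0)))"


section \<open>Spector's bar recursion and the explicitly controlled product of quantifiers\<close>

text \<open>The type parameters are \<open>(X, R)\<close>. All \<open>X\<^sub>i\<close> are the same type \<open>X\<close>, so that \<open>\<Pi>\<^sub>i X\<^sub>i\<close> and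
  \<open>\<Pi>\<^sub>i X\<^bsub>|s|+i\<^esub>\<close> are \<open>Nat \<rightarrowtail> X\<close>, and the types of finite sequences are \<open>Seq X\<close>.\<close>

abbreviation K_ty :: "ty \<Rightarrow> ty \<Rightarrow> ty" where
  "K_ty R X \<equiv> (X \<rightarrowtail> R) \<rightarrowtail> R"

definition BR_ty :: "ty \<times> ty \<Rightarrow> ty" where
  "BR_ty = (\<lambda>(X, R).
     ((Nat \<rightarrowtail> X) \<rightarrowtail> Nat) \<rightarrowtail> Seq X \<rightarrowtail> (Seq X \<rightarrowtail> K_ty R X) \<rightarrowtail> ((Nat \<rightarrowtail> X) \<rightarrowtail> R) \<rightarrowtail> R)"

text \<open>\<open>B \<cdot> \<omega> \<cdot> s \<cdot> \<phi> \<cdot> q\<close> is \<open>BR\<^sup>\<omega>\<^sub>s(\<phi>)(q)\<close>; here \<open>\<omega>\<close>, \<open>s\<close>, \<open>\<phi>\<close>, \<open>q\<close> are arbitrary terms.\<close>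

definition BR_eqn :: "ty \<Rightarrow> ty \<Rightarrow> tm \<Rightarrow> tm \<Rightarrow> tm \<Rightarrow> tm \<Rightarrow> tm \<Rightarrow> fm" where
  "BR_eqn X R B \<omega> s \<phi> q =
     Eq R (B \<cdot> \<omega> \<cdot> s \<cdot> \<phi> \<cdot> q)
       (Con (CondC R) \<cdot> (lessC \<cdot> (sect X \<omega> s \<cdot> zero (Nat \<rightarrowtail> X)) \<cdot> (lenC X \<cdot> s))
          \<cdot> (sect X q s \<cdot> zero (Nat \<rightarrowtail> X))
          \<cdot> (\<phi> \<cdot> s \<cdot> Lam X (lift 1 B \<cdot> lift 1 \<omega> \<cdot> snoc X (lift 1 s) (Var 0) \<cdot> lift 1 \<phi> \<cdot> lift 1 q)))"

definition BR :: "(ty \<times> ty) functional" where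
  "BR = \<lparr> fn_type = BR_ty,
          fn_eqn = (\<lambda>(X, R) B.
            All ((Nat \<rightarrowtail> X) \<rightarrowtail> Nat) (All (Seq X) (All (Seq X \<rightarrowtail> K_ty R X) (All ((Nat \<rightarrowtail> X) \<rightarrowtail> R)
              (BR_eqn X R (lift 4 B) (Var 3) (Var 2) (Var 1) (Var 0)))))) \<rparr>"

definition EPQ_ty :: "ty \<times> ty \<Rightarrow> ty" where
  "EPQ_ty = (\<lambda>(X, R).
     (R \<rightarrowtail> Nat) \<rightarrowtail> Seq X \<rightarrowtail> (Seq X \<rightarrowtail> K_ty R X) \<rightarrowtail> ((Nat \<rightarrowtail> X) \<rightarrowtail> R) \<rightarrowtail> R)"

text \<open>\<open>E \<cdot> l \<cdot> s \<cdot> \<phi> \<cdot> q\<close> is \<open>EPQ\<^sup>l\<^sub>s(\<phi>)(q)\<close>; in the recursive call \<open>q\<^sub>x\<close> is \<open>sect X q \<langle>x\<rangle>\<close>.\<close>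

definition EPQ_eqn :: "ty \<Rightarrow> ty \<Rightarrow> tm \<Rightarrow> tm \<Rightarrow> tm \<Rightarrow> tm \<Rightarrow> tm \<Rightarrow> fm" where
  "EPQ_eqn X R E l s \<phi> q =
     Eq R (E \<cdot> l \<cdot> s \<cdot> \<phi> \<cdot> q)
       (Con (CondC R) \<cdot> (lessC \<cdot> (l \<cdot> (q \<cdot> zero (Nat \<rightarrowtail> X))) \<cdot> (lenC X \<cdot> s))
          \<cdot> (q \<cdot> zero (Nat \<rightarrowtail> X))
          \<cdot> (\<phi> \<cdot> s \<cdot> Lam X (lift 1 E \<cdot> lift 1 l \<cdot> snoc X (lift 1 s) (Var 0) \<cdot> lift 1 \<phi>
                            \<cdot> sect X (lift 1 q) (snoc X (Con (NilC X)) (Var 0)))))"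

definition EPQ :: "(ty \<times> ty) functional" where
  "EPQ = \<lparr> fn_type = EPQ_ty,
           fn_eqn = (\<lambda>(X, R) E.
             All (R \<rightarrowtail> Nat) (All (Seq X) (All (Seq X \<rightarrowtail> K_ty R X) (All ((Nat \<rightarrowtail> X) \<rightarrowtail> R)
               (EPQ_eqn X R (lift 4 E) (Var 3) (Var 2) (Var 1) (Var 0)))))) \<rparr>"

end

theory Submission
  imports Defs
begin

text \<open>The functional \<open>EPQ\<^sup>l\<^sub>s(\<phi>)(q)\<close> is \<open>BR\<^sup>\<omega>\<^sub>s(\<phi>)(q')\<close> for \<open>q' \<alpha> = q (drop |s| \<alpha>)\<close> and \<open>\<omega> = l \<circ> q'\<close>.
  In the recursive call at \<open>s * x\<close> the right-hand side of \<open>BR\<close> keeps these \<open>q'\<close> and \<open>\<omega>\<close>, while \<open>EPQ\<close>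
  replaces them by others that agree with them on the extensions of \<open>s * x\<close> only. It thus remains to
  show that \<open>BR\<^sup>\<omega>\<^sub>t(\<phi>)(q)\<close> depends only on the values of \<open>\<omega>\<close> and \<open>q\<close> on the extensions of \<open>t\<close>. This is
  bar induction on \<open>u\<close> for the equation at \<open>t * u\<close>; the recursion stops along every \<open>\<alpha>\<close> by Spector's
  condition \<open>\<exists>n. \<omega> ([\<alpha>](n) * 0) < n\<close>. Spector's condition follows from \<open>BR\<close> with values in \<open>Nat\<close> by
  Kreisel's trick: bar recursion with \<open>\<phi>\<^sub>s p = p (\<alpha> |s|) + 1\<close> and \<open>q = 0\<close> counts the steps to a stopping
  point along \<open>\<alpha>\<close>. Since only one instance of \<open>BR\<close> is available, both recursions are run with values in
  \<open>Prod R Nat\<close>.\<close>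

section \<open>Substitution and typing\<close>

text \<open>The goal is provability, and a term of type \<open>Nat\<close> or \<open>Bool\<close>
  need not be provably equal to a numeral or a truth value. HOL induction on elements is therefore
  no substitute for induction in the theory. Whatever needs induction, case distinction or
  extensionality is derived inside the calculus, if it is to be reused then as a closed formula, and
  afterwards read at arbitrary elements; the rest is rewriting. Spector's condition does not fit the
  recursion directly. Along an extension of \<open>t\<close> it is applied to \<omega> shifted by
  \<open>t\<close>, and it then bounds a value by \<open>n\<close>, whereas the recursion compares
  with the length of \<open>t * [\<alpha>](n)\<close>; monotonicity of the comparison bridges the
  gap. Its proof must also be intuitionistic: the induction carries a disjunction, "a stopping point
  exists, or the count is still right", and only the boolean test is split. The product type works
  because each recursion embeds into it by filling the other component with a zero object: counting
  uses pairs \<open>(0, count)\<close>, the simulation of the product of quantifiers uses pairs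
  \<open>(value, 0)\<close>.\<close>

lemma ren_ren: "ren_tm r (ren_tm s t) = ren_tm (\<lambda>i. r (s i)) t"
proof (induction t arbitrary: r s)
  case (Lam T t)
  have "(\<lambda>i. ren_up r (ren_up s i)) = ren_up (\<lambda>i. r (s i))"
    by (auto simp: ren_up_def fun_eq_iff split: nat.split)
  with Lam show ?case by simp
qed auto

lemma sub_ren: "sub_tm \<sigma> (ren_tm r t) = sub_tm (\<lambda>i. \<sigma> (r i)) t"
proof (induction t arbitrary: \<sigma> r)
  case (Lam T t)
  have "(\<lambda>i. sub_up \<sigma> (ren_up r i)) = sub_up (\<lambda>i. \<sigma> (r i))"
    by (auto simp: ren_up_def sub_up_def fun_eq_iff split: nat.split)
  with Lam show ?case by simp
qed auto

lemma ren_sub: "ren_tm r (sub_tm \<sigma> t) = sub_tm (\<lambda>i. ren_tm r (\<sigma> i)) t"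
proof (induction t arbitrary: \<sigma> r)
  case (Lam T t)
  have "(\<lambda>i. ren_tm (ren_up r) (sub_up \<sigma> i)) = sub_up (\<lambda>i. ren_tm r (\<sigma> i))"
    by (auto simp: ren_up_def sub_up_def lift_def ren_ren fun_eq_iff split: nat.split)
  with Lam show ?case by simp
qed auto

lemma sub_up_simps [simp]:
  "sub_up \<sigma> 0 = Var 0"
  "sub_up \<sigma> (Suc n) = lift (Suc 0) (\<sigma> n)"
  "sub_up \<sigma> (numeral v) = lift (Suc 0) (\<sigma> (pred_numeral v))"
  by (simp_all add: sub_up_def numeral_eq_Suc)

lemma sub_up_lift: "sub_tm (sub_up \<sigma>) (lift (Suc 0) t) = lift (Suc 0) (sub_tm \<sigma> t)"
  by (simp add: lift_def sub_ren ren_sub sub_up_def)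

lemma sub_up_comp: "(\<lambda>i. sub_tm (sub_up \<sigma>) (sub_up \<tau> i)) = sub_up (\<lambda>i. sub_tm \<sigma> (\<tau> i))"
proof
  show "sub_tm (sub_up \<sigma>) (sub_up \<tau> i) = sub_up (\<lambda>i. sub_tm \<sigma> (\<tau> i)) i" for i
    by (cases i) (simp_all add: sub_up_lift)
qed

lemma sub_sub: "sub_tm \<sigma> (sub_tm \<tau> t) = sub_tm (\<lambda>i. sub_tm \<sigma> (\<tau> i)) t"
  by (induction t arbitrary: \<sigma> \<tau>) (auto simp: sub_up_comp)

lemma sub_up_Var: "sub_up Var = Var"
  by (auto simp: sub_up_def lift_def fun_eq_iff split: nat.split)

lemma sub_Var: "sub_tm Var t = t"
  by (induction t) (auto simp: sub_up_Var)

lemma sub_fm_sub_fm: "sub_fm \<sigma> (sub_fm \<tau> A) = sub_fm (\<lambda>i. sub_tm \<sigma> (\<tau> i)) A"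
  by (induction A arbitrary: \<sigma> \<tau>) (auto simp: sub_sub sub_up_comp)

lemma sub_fm_Var: "sub_fm Var A = A"
  by (induction A) (auto simp: sub_Var sub_up_Var)

lemma sub_case_lift: "sub_tm (case_nat u \<sigma>) (lift (Suc 0) t) = sub_tm \<sigma> t"
  by (simp add: lift_def sub_ren comp_def)

lemma sub_case_up: "(\<lambda>i. sub_tm (case_nat u Var) (sub_up \<sigma> i)) = case_nat u \<sigma>"
  by (auto simp: fun_eq_iff sub_up_def sub_case_lift sub_Var split: nat.split)

text \<open>Instantiating under a pending substitution merely extends it, so chains of universal
  eliminations keep the form \<open>sub_fm (case_nat t \<sigma>) A\<close>.\<close>

lemma inst_sub_up: "inst 0 (sub_fm (sub_up \<sigma>) A) u = sub_fm (case_nat u \<sigma>) A"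
proof -
  have "(\<lambda>i. Var (i + 0)) = Var" by simp
  then show ?thesis by (simp only: inst_def sub_fm_sub_fm sub_case_up)
qed

section \<open>Types computed by a partial function\<close>

primrec apty :: "ty option \<Rightarrow> ty option \<Rightarrow> ty option" where
  "apty None a = None"
| "apty (Some F) a = (case F of T \<rightarrowtail> U \<Rightarrow> if a = Some T then Some U else None | _ \<Rightarrow> None)"

text \<open>Makes typing a matter of evaluation, so that the simplifier settles it. Environments are
  functions, on which renaming and substitution act by composition.\<close>

primrec tyf :: "(nat \<Rightarrow> ty option) \<Rightarrow> tm \<Rightarrow> ty option" where
  "tyf e (Var i) = e i"
| "tyf e (Con c) = Some (con_ty c)"
| "tyf e (t \<cdot> u) = apty (tyf e t) (tyf e u)"
| "tyf e (Lam T t) = map_option (\<lambda>U. T \<rightarrowtail> U) (tyf (case_nat (Some T) e) t)"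

definition env :: "ty list \<Rightarrow> nat \<Rightarrow> ty option" where
  "env \<Gamma> i = (if i < length \<Gamma> then Some (\<Gamma> ! i) else None)"

lemma env_Cons [simp]: "env (T # \<Gamma>) = case_nat (Some T) (env \<Gamma>)"
  by (auto simp: env_def fun_eq_iff split: nat.split)

lemma apty_eq_Some: "apty f a = Some U \<longleftrightarrow> (\<exists>T. f = Some (T \<rightarrowtail> U) \<and> a = Some T)"
  by (cases f) (auto split: ty.splits if_splits)

lemma has_type_iff: "(\<Gamma> \<turnstile> t \<Ztypecolon> T) \<longleftrightarrow> tyf (env \<Gamma>) t = Some T"
proof
  show "\<Gamma> \<turnstile> t \<Ztypecolon> T \<Longrightarrow> tyf (env \<Gamma>) t = Some T"
    by (induction rule: has_type.induct) (auto simp: env_Cons, auto simp: env_def)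
  show "tyf (env \<Gamma>) t = Some T \<Longrightarrow> \<Gamma> \<turnstile> t \<Ztypecolon> T"
  proof (induction t arbitrary: \<Gamma> T)
    case (Var i)
    then show ?case by (auto simp: env_def intro: ty_Var split: if_splits)
  next
    case (Lam U t)
    then show ?case by (auto simp flip: env_Cons intro: ty_Lam)
  next
    case (Con c)
    then show ?case using ty_Con[of \<Gamma> c] by simp
  next
    case (App t u)
    from App.prems obtain U where "tyf (env \<Gamma>) t = Some (U \<rightarrowtail> T)" "tyf (env \<Gamma>) u = Some U"
      by (auto simp: apty_eq_Some)
    then show ?case using App.IH ty_App by blast
  qed
qed

lemma tyf_ren: "tyf e (ren_tm r t) = tyf (\<lambda>i. e (r i)) t"
proof (induction t arbitrary: e r)
  case (Lam T t)
  have "(\<lambda>i. case_nat (Some T) e (ren_up r i)) = case_nat (Some T) (\<lambda>i. e (r i))"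
    by (auto simp: ren_up_def fun_eq_iff split: nat.split)
  with Lam show ?case by simp
qed auto

lemma tyf_lift: "tyf (case_nat a e) (lift (Suc 0) t) = tyf e t"
  by (simp add: lift_def tyf_ren comp_def)

lemma tyf_sub: "tyf e (sub_tm \<sigma> t) = tyf (\<lambda>i. tyf e (\<sigma> i)) t"
proof (induction t arbitrary: e \<sigma>)
  case (Lam T t)
  have "(\<lambda>i. tyf (case_nat (Some T) e) (sub_up \<sigma> i)) = case_nat (Some T) (\<lambda>i. tyf e (\<sigma> i))"
    by (auto simp: sub_up_def tyf_lift fun_eq_iff split: nat.split)
  with Lam show ?case by simp
qed auto

section \<open>Derived rules for provable equality\<close>

abbreviation prov :: "ty list \<Rightarrow> fm set \<Rightarrow> fm \<Rightarrow> bool"  ("_ | _ \<tturnstile> _" [60, 60, 60] 60) where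
  "\<Gamma> | H \<tturnstile> A \<equiv> prv (HA_omega \<union> BI) \<Gamma> H A"

lemma prov_HA: "(\<Gamma>, A) \<in> HA_omega \<Longrightarrow> \<Gamma> | H \<tturnstile> A"
  by (rule Ax) simp

lemma AllE_sub: "\<Gamma> | H \<tturnstile> sub_fm \<sigma> (All T A) \<Longrightarrow> \<Gamma> \<turnstile> t \<Ztypecolon> T \<Longrightarrow> \<Gamma> | H \<tturnstile> sub_fm (case_nat t \<sigma>) A"
  using AllE[of _ \<Gamma> H T "sub_fm (sub_up \<sigma>) A" t] by (simp add: inst_sub_up)

text \<open>Leibniz's rule for two contexts \<open>p\<close> and \<open>q\<close> with hole
  \<open>Var 0\<close>; symmetry, transitivity and congruence are instances.\<close>

lemma Eq_subst:
  assumes "\<Gamma> | H \<tturnstile> Eq T t u" "T # \<Gamma> \<turnstile> p \<Ztypecolon> U" "T # \<Gamma> \<turnstile> q \<Ztypecolon> U"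
    and "\<Gamma> | H \<tturnstile> Eq U (sub_tm (case_nat t Var) p) (sub_tm (case_nat t Var) q)"
  shows "\<Gamma> | H \<tturnstile> Eq U (sub_tm (case_nat u Var) p) (sub_tm (case_nat u Var) q)"
proof -
  have i: "inst 0 (Eq U p q) v = Eq U (sub_tm (case_nat v Var) p) (sub_tm (case_nat v Var) q)" for v
    by (simp add: inst_def)
  have "\<Gamma> | H \<tturnstile> inst 0 (Eq U p q) u"
    by (rule EqE[OF _ assms(1)]) (use assms in \<open>simp_all add: i\<close>)
  then show ?thesis by (simp add: i)
qed

lemma lift_has_type: "\<Gamma> \<turnstile> t \<Ztypecolon> U \<Longrightarrow> T # \<Gamma> \<turnstile> lift (Suc 0) t \<Ztypecolon> U"
  by (simp add: has_type_iff env_Cons tyf_lift)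

lemma Var0_has_type: "T # \<Gamma> \<turnstile> Var 0 \<Ztypecolon> T"
  by (simp add: has_type_iff env_Cons)

lemma prov_sym:
  assumes "\<Gamma> \<turnstile> t \<Ztypecolon> T" "\<Gamma> | H \<tturnstile> Eq T t u" shows "\<Gamma> | H \<tturnstile> Eq T u t"
  using Eq_subst[OF assms(2) Var0_has_type lift_has_type[OF assms(1)]] assms(1)
  by (simp add: sub_case_lift sub_Var EqI)

lemma prov_trans:
  assumes "\<Gamma> \<turnstile> t \<Ztypecolon> T" "\<Gamma> | H \<tturnstile> Eq T t u" "\<Gamma> | H \<tturnstile> Eq T u v" shows "\<Gamma> | H \<tturnstile> Eq T t v"
  using Eq_subst[OF assms(3) lift_has_type[OF assms(1)] Var0_has_type] assms(2)
  by (simp add: sub_case_lift sub_Var)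

lemma prov_App:
  assumes "\<Gamma> \<turnstile> t \<Ztypecolon> (T \<rightarrowtail> U)" "\<Gamma> \<turnstile> u \<Ztypecolon> T" "\<Gamma> \<turnstile> t' \<Ztypecolon> (T \<rightarrowtail> U)"
    "\<Gamma> | H \<tturnstile> Eq (T \<rightarrowtail> U) t t'" "\<Gamma> | H \<tturnstile> Eq T u u'"
  shows "\<Gamma> | H \<tturnstile> Eq U (t \<cdot> u) (t' \<cdot> u')"
proof -
  note ty = ty_App[OF lift_has_type[OF assms(1)] lift_has_type[OF assms(2)]]
  have "\<Gamma> | H \<tturnstile> Eq U (t \<cdot> u) (t' \<cdot> u)"
    using Eq_subst[OF assms(4) ty ty_App[OF Var0_has_type lift_has_type[OF assms(2)]]]
      EqI[OF ty_App[OF assms(1,2)]]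
    by (simp add: sub_case_lift sub_Var)
  then show ?thesis
    using Eq_subst[OF assms(5) ty ty_App[OF lift_has_type[OF assms(3)] Var0_has_type]]
    by (simp add: sub_case_lift sub_Var)
qed

section \<open>The term model\<close>

text \<open>In a fixed context with fixed hypotheses, terms modulo provable equality form an applicative
  structure, in which provable equations become equations of HOL and hence rewrite rules. An element of
  this structure need not be given as the class of a term, whence the evaluation \<open>ev\<close> of a term in an
  environment of elements.\<close>

type_synonym world = "ty list \<times> fm set"

definition eqv :: "world \<Rightarrow> tm \<Rightarrow> tm \<Rightarrow> bool" where
  "eqv w t u \<longleftrightarrow> (\<exists>T. (fst w \<turnstile> t \<Ztypecolon> T) \<and> (fst w \<turnstile> u \<Ztypecolon> T) \<and> fst w | snd w \<tturnstile> Eq T t u)"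

definition cls :: "world \<Rightarrow> tm \<Rightarrow> tm set" where
  "cls w t = {u. eqv w t u}"

text \<open>Ill-typed terms have the empty class, which is why the representative of anything that is not
  the class of a typed term is chosen to be an ill-typed term.\<close>

definition rep :: "world \<Rightarrow> tm set \<Rightarrow> tm" where
  "rep w a = (if \<exists>t. a = cls w t \<and> a \<noteq> {} then SOME t. a = cls w t else Var (length (fst w)))"

definition tyof :: "world \<Rightarrow> tm set \<Rightarrow> ty option" where
  "tyof w a = tyf (env (fst w)) (rep w a)"

definition ap :: "world \<Rightarrow> tm set \<Rightarrow> tm set \<Rightarrow> tm set" where
  "ap w a b = cls w (rep w a \<cdot> rep w b)"

definition ev :: "world \<Rightarrow> (nat \<Rightarrow> tm set) \<Rightarrow> tm \<Rightarrow> tm set" where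
  "ev w \<rho> t = cls w (sub_tm (\<lambda>i. rep w (\<rho> i)) t)"

abbreviation ap_infix :: "tm set \<Rightarrow> world \<Rightarrow> tm set \<Rightarrow> tm set"  ("(_ \<bullet>\<^bsub>_\<^esub>/ _)" [200, 0, 201] 200) where
  "a \<bullet>\<^bsub>w\<^esub> b \<equiv> ap w a b"

lemma eqv_refl: "fst w \<turnstile> t \<Ztypecolon> T \<Longrightarrow> eqv w t t"
  by (auto simp: eqv_def intro: EqI)

lemma eqv_sym: "eqv w t u \<Longrightarrow> eqv w u t"
  by (auto simp: eqv_def intro: prov_sym)

lemma eqv_trans:
  assumes "eqv w t u" "eqv w u v" shows "eqv w t v"
proof -
  from assms obtain T where "fst w \<turnstile> t \<Ztypecolon> T" "fst w \<turnstile> v \<Ztypecolon> T"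
    "fst w | snd w \<tturnstile> Eq T t u" "fst w | snd w \<tturnstile> Eq T u v"
    by (auto simp: eqv_def has_type_iff)
  then show ?thesis unfolding eqv_def by (blast intro: prov_trans)
qed

lemma eqv_App:
  assumes "eqv w t t'" "eqv w u u'" "fst w \<turnstile> t \<cdot> u \<Ztypecolon> U"
  shows "eqv w (t \<cdot> u) (t' \<cdot> u')"
proof -
  from assms(3) obtain T where "fst w \<turnstile> t \<Ztypecolon> (T \<rightarrowtail> U)" "fst w \<turnstile> u \<Ztypecolon> T"
    by (auto simp: has_type_iff apty_eq_Some)
  moreover from this assms(1,2) have "fst w \<turnstile> t' \<Ztypecolon> (T \<rightarrowtail> U)" "fst w \<turnstile> u' \<Ztypecolon> T"
    "fst w | snd w \<tturnstile> Eq (T \<rightarrowtail> U) t t'" "fst w | snd w \<tturnstile> Eq T u u'"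
    by (auto simp: eqv_def has_type_iff)
  ultimately show ?thesis
    unfolding eqv_def by (meson ty_App prov_App)
qed

lemma cls_eq_iff: "fst w \<turnstile> t \<Ztypecolon> T \<Longrightarrow> cls w t = cls w u \<longleftrightarrow> eqv w t u"
  unfolding cls_def by (auto dest: eqv_sym eqv_trans eqv_refl)

lemma cls_empty: "cls w t = {} \<longleftrightarrow> tyf (env (fst w)) t = None"
proof -
  have "eqv w t u \<Longrightarrow> tyf (env (fst w)) t \<noteq> None" for u
    by (auto simp: eqv_def has_type_iff)
  moreover have "tyf (env (fst w)) t = Some T \<Longrightarrow> eqv w t t" for T
    by (auto simp: has_type_iff intro: eqv_refl)
  ultimately show ?thesis
    by (cases "tyf (env (fst w)) t") (auto simp: cls_def)
qed

lemma cls_rep_if: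
  assumes "a = cls w t" "a \<noteq> {}" shows "cls w (rep w a) = a"
proof -
  have "rep w a = (SOME t. a = cls w t)" using assms by (auto simp: rep_def)
  moreover have "a = cls w (SOME t. a = cls w t)" using assms(1) by (rule someI)
  ultimately show ?thesis by simp
qed

lemma rep_junk: "\<not> (\<exists>t. a = cls w t \<and> a \<noteq> {}) \<Longrightarrow> rep w a = Var (length (fst w))"
  unfolding rep_def by (rule if_not_P)

lemma cls_rep:
  assumes "tyof w a = Some T" shows "cls w (rep w a) = a"
proof -
  have "\<exists>t. a = cls w t \<and> a \<noteq> {}"
  proof (rule ccontr)
    assume "\<not> ?thesis"
    then have "rep w a = Var (length (fst w))" by (rule rep_junk)
    then show False using assms by (simp add: tyof_def env_def)
  qed
  then show ?thesis using cls_rep_if by metis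
qed

text \<open>No typing is assumed: for an ill-typed \<open>t\<close> the representative is
  \<open>Var (length (fst w))\<close>, whose class is empty as well.\<close>

lemma cls_rep_cls: "cls w (rep w (cls w t)) = cls w t"
proof (cases "cls w t = {}")
  case True
  then have "rep w (cls w t) = Var (length (fst w))" by (intro rep_junk) simp
  moreover have "cls w (Var (length (fst w))) = {}" by (simp add: cls_empty env_def)
  ultimately show ?thesis using True by simp
qed (rule cls_rep_if, simp_all)

lemma cls_eq_tyf: "cls w t = cls w u \<Longrightarrow> tyf (env (fst w)) t = tyf (env (fst w)) u"
  by (metis cls_empty cls_eq_iff eqv_def has_type_iff option.exhaust)

lemma tyof_cls [simp]: "tyof w (cls w t) = tyf (env (fst w)) t"
  unfolding tyof_def by (rule cls_eq_tyf) (rule cls_rep_cls)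

text \<open>If \<open>t \<cdot> u\<close> is ill-typed, so is the application of the
  representatives, and both classes are empty. Hence the rule needs no side condition and can always
  push \<open>cls\<close> inwards.\<close>

lemma cls_App [simp]: "cls w (t \<cdot> u) = cls w t \<bullet>\<^bsub>w\<^esub> cls w u"
proof (cases "tyf (env (fst w)) (t \<cdot> u)")
  case None
  have "tyf (env (fst w)) (rep w (cls w t) \<cdot> rep w (cls w u)) = None"
    using None by (simp add: cls_eq_tyf[OF cls_rep_cls])
  then show ?thesis unfolding ap_def using None cls_empty by blast
next
  case (Some U)
  then obtain T where T: "fst w \<turnstile> t \<Ztypecolon> (T \<rightarrowtail> U)" "fst w \<turnstile> u \<Ztypecolon> T"
    by (auto simp: apty_eq_Some has_type_iff)
  have "eqv w t (rep w (cls w t))" "eqv w u (rep w (cls w u))"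
    using T cls_eq_iff cls_rep_cls by metis+
  then show ?thesis unfolding ap_def
    using Some by (subst cls_eq_iff[where T=U])
      (auto intro: eqv_App simp: has_type_iff simp del: tyf.simps)
qed

lemma tyof_ap [simp]: "tyof w (a \<bullet>\<^bsub>w\<^esub> b) = apty (tyof w a) (tyof w b)"
  unfolding ap_def by (simp del: cls_App) (simp add: tyof_def)

lemma cls_eqI: "\<Gamma> | H \<tturnstile> Eq T t u \<Longrightarrow> \<Gamma> \<turnstile> t \<Ztypecolon> T \<Longrightarrow> \<Gamma> \<turnstile> u \<Ztypecolon> T \<Longrightarrow> cls (\<Gamma>, H) t = cls (\<Gamma>, H) u"
  by (subst cls_eq_iff[where T=T]) (auto simp: eqv_def)

lemma EqI_cls: "cls (\<Gamma>, H) t = cls (\<Gamma>, H) u \<Longrightarrow> tyf (env \<Gamma>) t = Some T \<Longrightarrow> \<Gamma> | H \<tturnstile> Eq T t u"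
  by (subst (asm) cls_eq_iff[where T=T]) (auto simp: eqv_def has_type_iff)

lemma ev_Var [simp]: "tyof w (\<rho> i) = Some T \<Longrightarrow> ev w \<rho> (Var i) = \<rho> i"
  by (simp add: ev_def cls_rep)

lemma ev_Con [simp]: "ev w \<rho> (Con c) = cls w (Con c)"
  by (simp add: ev_def)

lemma ev_App [simp]: "ev w \<rho> (t \<cdot> u) = ev w \<rho> t \<bullet>\<^bsub>w\<^esub> ev w \<rho> u"
  by (simp add: ev_def)

lemma tyof_ev [simp]: "tyof w (ev w \<rho> t) = tyf (\<lambda>i. tyof w (\<rho> i)) t"
  by (simp add: ev_def tyf_sub) (simp add: tyof_def)

lemma case_nat_comp: "(\<lambda>i. f (case_nat a g i)) = case_nat (f a) (\<lambda>i. f (g i))"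
  by (auto split: nat.split)

lemma ap_cls_Lam [simp]:
  assumes "tyf (env (fst w)) u = Some T" "tyf (env (T # fst w)) t = Some U"
  shows "cls w (Lam T t) \<bullet>\<^bsub>w\<^esub> cls w u = cls w (sub_tm (case_nat u Var) t)"
proof -
  have "(\<lambda>i. tyf (env (fst w)) (case_nat u Var i)) = env (T # fst w)"
    using assms(1) by (auto simp: env_Cons fun_eq_iff split: nat.split)
  then have "fst w \<turnstile> sub_tm (case_nat u Var) t \<Ztypecolon> U"
    using assms(2) by (simp add: tyf_sub has_type_iff)
  moreover have "fst w | snd w \<tturnstile> Eq U (Lam T t \<cdot> u) (sub_tm (case_nat u Var) t)"
    using assms by (intro prov_HA beta) (auto simp: has_type_iff)
  moreover have "fst w \<turnstile> Lam T t \<cdot> u \<Ztypecolon> U"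
    using assms by (intro ty_App ty_Lam) (auto simp: has_type_iff)
  ultimately show ?thesis using cls_eqI[of "fst w" "snd w"] by (simp flip: cls_App)
qed

text \<open>Beta for an argument that is an element instead of a term: nothing is substituted into
  \<open>t\<close>, the environment grows instead.\<close>

lemma ap_ev_Lam [simp]:
  assumes "tyof w a = Some T" "tyf (\<lambda>i. tyof w (case_nat a \<rho> i)) t = Some U"
  shows "ev w \<rho> (Lam T t) \<bullet>\<^bsub>w\<^esub> a = ev w (case_nat a \<rho>) t"
proof -
  let ?\<sigma> = "\<lambda>i. rep w (\<rho> i)" and ?t = "sub_tm (sub_up (\<lambda>i. rep w (\<rho> i))) t"
  have "(\<lambda>i. tyf (env (T # fst w)) (sub_up ?\<sigma> i)) = (\<lambda>i. tyof w (case_nat a \<rho> i))"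
    using assms(1) by (auto simp: fun_eq_iff sub_up_def env_Cons tyf_lift tyof_def split: nat.split)
  then have "tyf (env (T # fst w)) ?t = Some U" using assms(2) by (simp add: tyf_sub)
  moreover have "tyf (env (fst w)) (rep w a) = Some T"
    using assms(1) by (simp add: tyof_def)
  ultimately have "cls w (Lam T ?t) \<bullet>\<^bsub>w\<^esub> cls w (rep w a) = cls w (sub_tm (case_nat (rep w a) Var) ?t)"
    by simp
  moreover have "(\<lambda>i. rep w (case_nat a \<rho> i)) = case_nat (rep w a) ?\<sigma>"
    by (rule case_nat_comp)
  ultimately show ?thesis
    using cls_rep[OF assms(1)] by (simp add: ev_def sub_sub sub_case_up)
qed

text \<open>A variable without a type in \<open>e\<close> cannot occur free in a term typable under
  \<open>e\<close>, so \<open>\<sigma>\<close> matters only on the domain of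
  \<open>e\<close>.\<close>

lemma sub_tm_id: "tyf e t = Some T \<Longrightarrow> (\<And>i. e i \<noteq> None \<Longrightarrow> \<sigma> i = Var i) \<Longrightarrow> sub_tm \<sigma> t = t"
proof (induction t arbitrary: e \<sigma> T)
  case (Lam U t)
  have "sub_up \<sigma> i = Var i" if "case_nat (Some U) e i \<noteq> None" for i
    using that Lam.prems(2) by (auto simp: sub_up_def lift_def split: nat.splits)
  then show ?case using Lam by auto
next
  case (App t u)
  then obtain U where "tyf e t = Some (U \<rightarrowtail> T)" "tyf e u = Some U"
    by (auto simp: apty_eq_Some)
  then show ?case using App.IH(1)[OF _ App.prems(2)] App.IH(2)[OF _ App.prems(2)] by simp
qed auto

lemma ren_tm_sub: "ren_tm r t = sub_tm (\<lambda>i. Var (r i)) t"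
  using ren_sub[of r Var t] by (simp add: sub_Var)

text \<open>Typability in every environment includes the empty one, which forces closedness. The
  typing lemma of each operation thus also yields its invariance under substitution.\<close>

lemma sub_tm_closed: "(\<And>e. tyf e t = Some T) \<Longrightarrow> sub_tm \<sigma> t = t"
  by (rule sub_tm_id[where e="\<lambda>_. None"]) auto

lemma closed_simps:
  assumes "\<And>e. tyf e t = Some T"
  shows "sub_tm \<sigma> t = t" "ren_tm r t = t" "lift k t = t" "ev w \<rho> t = cls w t"
  by (simp_all add: sub_tm_closed[OF assms] ren_tm_sub lift_def ev_def)

lemma sub_fm_id: "wf_fm \<Gamma> A \<Longrightarrow> (\<And>i. i < length \<Gamma> \<Longrightarrow> \<sigma> i = Var i) \<Longrightarrow> sub_fm \<sigma> A = A"
proof (induction A arbitrary: \<Gamma> \<sigma>)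
  case (Eq T t u)
  then show ?case by (auto simp: has_type_iff env_def intro!: sub_tm_id split: if_splits)
next
  case (All T A)
  have "sub_up \<sigma> i = Var i" if "i < length (T # \<Gamma>)" for i
    using that All.prems(2) by (auto simp: sub_up_def lift_def split: nat.splits)
  then show ?case using All.IH[of "T # \<Gamma>" "sub_up \<sigma>"] All.prems(1) by simp
next
  case (Ex T A)
  have "sub_up \<sigma> i = Var i" if "i < length (T # \<Gamma>)" for i
    using that Ex.prems(2) by (auto simp: sub_up_def lift_def split: nat.splits)
  then show ?case using Ex.IH[of "T # \<Gamma>" "sub_up \<sigma>"] Ex.prems(1) by simp
qed auto

lemma sub_fm_closed: "wf_fm [] A \<Longrightarrow> sub_fm \<sigma> A = A"
  by (rule sub_fm_id) auto

section \<open>Truth of formulas at elements\<close>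

definition holds :: "world \<Rightarrow> (nat \<Rightarrow> tm set) \<Rightarrow> fm \<Rightarrow> bool" where
  "holds w \<rho> A \<longleftrightarrow> fst w | snd w \<tturnstile> sub_fm (\<lambda>i. rep w (\<rho> i)) A"

lemma holds_closed: "fst w | snd w \<tturnstile> A \<Longrightarrow> wf_fm [] A \<Longrightarrow> holds w \<rho> A"
  by (simp add: holds_def sub_fm_closed)

lemma holds_All: "holds w \<rho> (All T A) \<Longrightarrow> tyof w a = Some T \<Longrightarrow> holds w (case_nat a \<rho>) A"
  unfolding holds_def using AllE_sub[where t="rep w a"]
  by (simp add: case_nat_comp has_type_iff tyof_def)

lemma holds_Eq:
  assumes "holds w \<rho> (Eq T t u)" "tyf (\<lambda>i. tyof w (\<rho> i)) t = Some T"
    "tyf (\<lambda>i. tyof w (\<rho> i)) u = Some T"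
  shows "ev w \<rho> t = ev w \<rho> u"
  using assms cls_eqI[of "fst w" "snd w"]
  by (auto simp: holds_def ev_def has_type_iff tyf_sub tyof_def)

text \<open>Discharges a premise that is an equation between elements. Together with
  \<open>holds_closed\<close>, \<open>holds_All\<close> and \<open>holds_Eq\<close> it turns a
  provable closed formula into a rule about arbitrary elements.\<close>

lemma holds_Imp_Eq:
  assumes "holds w \<rho> (Eq T t u \<rightarrow>\<^sub>f A)" "ev w \<rho> t = ev w \<rho> u" "tyf (\<lambda>i. tyof w (\<rho> i)) t = Some T"
  shows "holds w \<rho> A"
proof -
  let ?\<sigma> = "\<lambda>i. rep w (\<rho> i)"
  have "fst w | snd w \<tturnstile> Eq T (sub_tm ?\<sigma> t) (sub_tm ?\<sigma> u)"
    using assms(2,3) by (intro EqI_cls) (auto simp: ev_def tyf_sub tyof_def)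
  then show ?thesis using assms(1) ImpE by (auto simp: holds_def)
qed

text \<open>The extensionality axiom: functions are compared at a generic argument, a fresh
  variable, hence in the world that has this variable and the lifted hypotheses.\<close>

lemma xi_cls:
  assumes "\<Gamma> \<turnstile> f \<Ztypecolon> (T \<rightarrowtail> U)" "\<Gamma> \<turnstile> g \<Ztypecolon> (T \<rightarrowtail> U)"
    and "cls (T # \<Gamma>, lift_fm ` H) (lift 1 f \<cdot> Var 0) = cls (T # \<Gamma>, lift_fm ` H) (lift 1 g \<cdot> Var 0)"
  shows "cls (\<Gamma>, H) f = cls (\<Gamma>, H) g"
proof (rule cls_eqI[OF _ assms(1,2)])
  have "T # \<Gamma> | lift_fm ` H \<tturnstile> Eq U (lift 1 f \<cdot> Var 0) (lift 1 g \<cdot> Var 0)"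
    by (rule EqI_cls[OF assms(3)]) (use assms(1) in \<open>simp add: has_type_iff tyf_lift\<close>)
  then show "\<Gamma> | H \<tturnstile> Eq (T \<rightarrowtail> U) f g"
    by (intro ImpE[OF prov_HA[OF ext[OF assms(1,2)]]] AllI)
qed

section \<open>Numbers and sequences\<close>

lemma tyf_predC [simp]: "tyf e predC = Some (Nat \<rightarrowtail> Nat)"
  by (simp add: predC_def)

lemma tyf_minusC [simp]: "tyf e minusC = Some (Nat \<rightarrowtail> Nat \<rightarrowtail> Nat)"
  by (simp add: minusC_def)

lemma tyf_lessC [simp]: "tyf e lessC = Some (Nat \<rightarrowtail> Nat \<rightarrowtail> Bool)"
  by (simp add: lessC_def)

lemma tyf_lenC [simp]: "tyf e (lenC X) = Some (Seq X \<rightarrowtail> Nat)"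
  by (simp add: lenC_def)

lemma tyf_consC [simp]: "tyf e (consC X) = Some (X \<rightarrowtail> (Nat \<rightarrowtail> X) \<rightarrowtail> Nat \<rightarrowtail> X)"
  by (simp add: consC_def)

lemma tyf_catC [simp]: "tyf e (catC X) = Some (Seq X \<rightarrowtail> (Nat \<rightarrowtail> X) \<rightarrowtail> Nat \<rightarrowtail> X)"
  by (simp add: catC_def)

lemma tyf_initC [simp]: "tyf e (initC X) = Some ((Nat \<rightarrowtail> X) \<rightarrowtail> Nat \<rightarrowtail> Seq X)"
  by (simp add: initC_def)

lemma tyf_zero [simp]: "tyf e (zero T) = Some T"
  by (induction T arbitrary: e) auto

text \<open>The successor test inside \<open>lessC\<close>, split off so that
  \<open>less_pos\<close> reduces comparisons to subtraction.\<close>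

definition posC :: tm where
  "posC = Con (RecC Bool) \<cdot> Con FalseC \<cdot> Lam Nat (Lam Bool (Con TrueC))"

definition tailC :: "ty \<Rightarrow> tm" where
  "tailC X = Lam (Nat \<rightarrowtail> X) (Lam Nat (Var 1 \<cdot> (Con SucC \<cdot> Var 0)))"

text \<open>Recursion on the sequence itself, whose entries are ignored, instead of on its length:
  this matches the recursion of \<open>catC\<close>, and \<open>drop_cat\<close> becomes a direct
  induction.\<close>

definition dropC :: "ty \<Rightarrow> tm" where
  "dropC X = Con (SRecC X ((Nat \<rightarrowtail> X) \<rightarrowtail> Nat \<rightarrowtail> X))
     \<cdot> Lam (Nat \<rightarrowtail> X) (Var 0)
     \<cdot> Lam (Seq X) (Lam X (Lam ((Nat \<rightarrowtail> X) \<rightarrowtail> Nat \<rightarrowtail> X) (Lam (Nat \<rightarrowtail> X)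
          (tailC X \<cdot> (Var 1 \<cdot> Var 0)))))"

definition fcatC :: "ty \<Rightarrow> tm" where
  "fcatC X = Lam (Seq X) (Con (SRecC X (Seq X)) \<cdot> Var 0
     \<cdot> Lam (Seq X) (Lam X (Lam (Seq X) (snoc X (Var 0) (Var 1)))))"

lemma tyf_posC [simp]: "tyf e posC = Some (Nat \<rightarrowtail> Bool)"
  by (simp add: posC_def)

lemma tyf_tailC [simp]: "tyf e (tailC X) = Some ((Nat \<rightarrowtail> X) \<rightarrowtail> Nat \<rightarrowtail> X)"
  by (simp add: tailC_def)

lemma tyf_dropC [simp]: "tyf e (dropC X) = Some (Seq X \<rightarrowtail> (Nat \<rightarrowtail> X) \<rightarrowtail> Nat \<rightarrowtail> X)"
  by (simp add: dropC_def)

lemma tyf_fcatC [simp]: "tyf e (fcatC X) = Some (Seq X \<rightarrowtail> Seq X \<rightarrowtail> Seq X)"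
  by (simp add: fcatC_def)

lemmas closed_consts [simp] =
  closed_simps[OF tyf_predC] closed_simps[OF tyf_minusC] closed_simps[OF tyf_lessC]
  closed_simps[OF tyf_lenC] closed_simps[OF tyf_consC] closed_simps[OF tyf_catC]
  closed_simps[OF tyf_initC] closed_simps[OF tyf_zero] closed_simps[OF tyf_posC]
  closed_simps[OF tyf_tailC] closed_simps[OF tyf_dropC] closed_simps[OF tyf_fcatC]

text \<open>Presents a closed term as an evaluation in some environment, so that
  \<open>ap_ev_Lam\<close> can compute its applications to elements.\<close>

lemma cls_ev: "(\<And>e. tyf e t = Some T) \<Longrightarrow> cls w t = ev w (\<lambda>_. {}) t"
  by (simp add: closed_simps(4))

declare zero.simps [simp del]

section \<open>Axioms and operations as rewrite rules on elements\<close>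

lemma HA_cls:
  assumes "(fst w, Eq T t u) \<in> HA_omega" "fst w \<turnstile> t \<Ztypecolon> T" "fst w \<turnstile> u \<Ztypecolon> T"
  shows "cls w t = cls w u"
  using cls_eqI[OF prov_HA[OF assms(1)] assms(2,3), of "snd w"] by simp

lemma tyf_rep: "tyf (env (fst w)) (rep w a) = tyof w a"
  by (simp add: tyof_def)

lemma rep_has_type: "tyof w a = Some T \<Longrightarrow> fst w \<turnstile> rep w a \<Ztypecolon> T"
  by (simp add: tyf_rep has_type_iff)

declare cls_rep [simp]

lemma cond_true_el [simp]:
  assumes "tyof w a = Some T" "tyof w b = Some T"
  shows "cls w (Con (CondC T)) \<bullet>\<^bsub>w\<^esub> cls w (Con TrueC) \<bullet>\<^bsub>w\<^esub> a \<bullet>\<^bsub>w\<^esub> b = a"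
  using HA_cls[OF cond_true[OF rep_has_type[OF assms(1)] rep_has_type[OF assms(2)]]] assms
  by (simp add: has_type_iff tyf_rep)

lemma cond_false_el [simp]:
  assumes "tyof w a = Some T" "tyof w b = Some T"
  shows "cls w (Con (CondC T)) \<bullet>\<^bsub>w\<^esub> cls w (Con FalseC) \<bullet>\<^bsub>w\<^esub> a \<bullet>\<^bsub>w\<^esub> b = b"
  using HA_cls[OF cond_false[OF rep_has_type[OF assms(1)] rep_has_type[OF assms(2)]]] assms
  by (simp add: has_type_iff tyf_rep)

lemma fst_pair_el [simp]:
  assumes "tyof w a = Some T" "tyof w b = Some U"
  shows "cls w (Con (FstC T U)) \<bullet>\<^bsub>w\<^esub> (cls w (Con (PairC T U)) \<bullet>\<^bsub>w\<^esub> a \<bullet>\<^bsub>w\<^esub> b) = a"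
  using HA_cls[OF fst_pair[OF rep_has_type[OF assms(1)] rep_has_type[OF assms(2)]]] assms
  by (simp add: has_type_iff tyf_rep)

lemma snd_pair_el [simp]:
  assumes "tyof w a = Some T" "tyof w b = Some U"
  shows "cls w (Con (SndC T U)) \<bullet>\<^bsub>w\<^esub> (cls w (Con (PairC T U)) \<bullet>\<^bsub>w\<^esub> a \<bullet>\<^bsub>w\<^esub> b) = b"
  using HA_cls[OF snd_pair[OF rep_has_type[OF assms(1)] rep_has_type[OF assms(2)]]] assms
  by (simp add: has_type_iff tyf_rep)

lemma rec_zero_el [simp]:
  assumes "tyof w a = Some T" "tyof w f = Some (Nat \<rightarrowtail> T \<rightarrowtail> T)"
  shows "cls w (Con (RecC T)) \<bullet>\<^bsub>w\<^esub> a \<bullet>\<^bsub>w\<^esub> f \<bullet>\<^bsub>w\<^esub> cls w (Con ZeroC) = a"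
  using HA_cls[OF rec_zero[OF rep_has_type[OF assms(1)] rep_has_type[OF assms(2)]]] assms
  by (simp add: has_type_iff tyf_rep)

lemma rec_suc_el [simp]:
  assumes "tyof w a = Some T" "tyof w f = Some (Nat \<rightarrowtail> T \<rightarrowtail> T)" "tyof w n = Some Nat"
  shows "cls w (Con (RecC T)) \<bullet>\<^bsub>w\<^esub> a \<bullet>\<^bsub>w\<^esub> f \<bullet>\<^bsub>w\<^esub> (cls w (Con SucC) \<bullet>\<^bsub>w\<^esub> n)
    = f \<bullet>\<^bsub>w\<^esub> n \<bullet>\<^bsub>w\<^esub> (cls w (Con (RecC T)) \<bullet>\<^bsub>w\<^esub> a \<bullet>\<^bsub>w\<^esub> f \<bullet>\<^bsub>w\<^esub> n)"
  using HA_cls[OF rec_suc[OF rep_has_type[OF assms(1)] rep_has_type[OF assms(2)]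
    rep_has_type[OF assms(3)]]] assms
  by (simp add: has_type_iff tyf_rep)

lemma srec_nil_el [simp]:
  assumes "tyof w a = Some T" "tyof w f = Some (Seq X \<rightarrowtail> X \<rightarrowtail> T \<rightarrowtail> T)"
  shows "cls w (Con (SRecC X T)) \<bullet>\<^bsub>w\<^esub> a \<bullet>\<^bsub>w\<^esub> f \<bullet>\<^bsub>w\<^esub> cls w (Con (NilC X)) = a"
  using HA_cls[OF srec_nil[OF rep_has_type[OF assms(1)] rep_has_type[OF assms(2)]]] assms
  by (simp add: has_type_iff tyf_rep)

lemma srec_snoc_el [simp]:
  assumes "tyof w a = Some T" "tyof w f = Some (Seq X \<rightarrowtail> X \<rightarrowtail> T \<rightarrowtail> T)"
    "tyof w s = Some (Seq X)" "tyof w x = Some X"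
  shows "cls w (Con (SRecC X T)) \<bullet>\<^bsub>w\<^esub> a \<bullet>\<^bsub>w\<^esub> f \<bullet>\<^bsub>w\<^esub> (cls w (Con (SnocC X)) \<bullet>\<^bsub>w\<^esub> s \<bullet>\<^bsub>w\<^esub> x)
    = f \<bullet>\<^bsub>w\<^esub> s \<bullet>\<^bsub>w\<^esub> x \<bullet>\<^bsub>w\<^esub> (cls w (Con (SRecC X T)) \<bullet>\<^bsub>w\<^esub> a \<bullet>\<^bsub>w\<^esub> f \<bullet>\<^bsub>w\<^esub> s)"
  using HA_cls[OF srec_snoc[OF rep_has_type[OF assms(1)] rep_has_type[OF assms(2)]
    rep_has_type[OF assms(3)] rep_has_type[OF assms(4)]]] assms
  by (simp add: has_type_iff tyf_rep)

lemma pred_zero [simp]: "cls w predC \<bullet>\<^bsub>w\<^esub> cls w (Con ZeroC) = cls w (Con ZeroC)"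
  by (subst cls_ev[OF tyf_predC]) (simp add: predC_def)

lemma pred_suc [simp]: "tyof w n = Some Nat \<Longrightarrow> cls w predC \<bullet>\<^bsub>w\<^esub> (cls w (Con SucC) \<bullet>\<^bsub>w\<^esub> n) = n"
  by (subst cls_ev[OF tyf_predC]) (simp add: predC_def)

lemma pos_zero [simp]: "cls w posC \<bullet>\<^bsub>w\<^esub> cls w (Con ZeroC) = cls w (Con FalseC)"
  by (subst cls_ev[OF tyf_posC]) (simp add: posC_def)

lemma pos_suc [simp]: "tyof w n = Some Nat \<Longrightarrow>
    cls w posC \<bullet>\<^bsub>w\<^esub> (cls w (Con SucC) \<bullet>\<^bsub>w\<^esub> n) = cls w (Con TrueC)"
  by (subst cls_ev[OF tyf_posC]) (simp add: posC_def)

lemma minus_zero [simp]: "tyof w n = Some Nat \<Longrightarrow> cls w minusC \<bullet>\<^bsub>w\<^esub> n \<bullet>\<^bsub>w\<^esub> cls w (Con ZeroC) = n"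
  by (subst cls_ev[OF tyf_minusC]) (simp add: minusC_def)

lemma minus_suc: "tyof w n = Some Nat \<Longrightarrow> tyof w m = Some Nat \<Longrightarrow>
  cls w minusC \<bullet>\<^bsub>w\<^esub> n \<bullet>\<^bsub>w\<^esub> (cls w (Con SucC) \<bullet>\<^bsub>w\<^esub> m) = cls w predC \<bullet>\<^bsub>w\<^esub> (cls w minusC \<bullet>\<^bsub>w\<^esub> n \<bullet>\<^bsub>w\<^esub> m)"
  by (subst (1 2) cls_ev[OF tyf_minusC]) (simp add: minusC_def)

lemma less_pos: "tyof w n = Some Nat \<Longrightarrow> tyof w m = Some Nat \<Longrightarrow>
  cls w lessC \<bullet>\<^bsub>w\<^esub> n \<bullet>\<^bsub>w\<^esub> m = cls w posC \<bullet>\<^bsub>w\<^esub> (cls w minusC \<bullet>\<^bsub>w\<^esub> m \<bullet>\<^bsub>w\<^esub> n)"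
  using closed_simps(4)[of "Lam Nat (Lam Bool (Con TrueC))" "Nat \<rightarrowtail> Bool \<rightarrowtail> Bool"]
  by (subst cls_ev[OF tyf_lessC], subst cls_ev[OF tyf_posC]) (simp add: lessC_def posC_def)

lemma len_nil [simp]: "cls w (lenC X) \<bullet>\<^bsub>w\<^esub> cls w (Con (NilC X)) = cls w (Con ZeroC)"
  by (subst cls_ev[OF tyf_lenC]) (simp add: lenC_def)

lemma len_snoc [simp]: "tyof w s = Some (Seq X) \<Longrightarrow> tyof w x = Some X \<Longrightarrow>
  cls w (lenC X) \<bullet>\<^bsub>w\<^esub> (cls w (Con (SnocC X)) \<bullet>\<^bsub>w\<^esub> s \<bullet>\<^bsub>w\<^esub> x) = cls w (Con SucC) \<bullet>\<^bsub>w\<^esub> (cls w (lenC X) \<bullet>\<^bsub>w\<^esub> s)"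
  by (subst (1 2) cls_ev[OF tyf_lenC]) (simp add: lenC_def)

lemma cons_suc [simp]: "tyof w x = Some X \<Longrightarrow> tyof w a = Some (Nat \<rightarrowtail> X) \<Longrightarrow> tyof w n = Some Nat \<Longrightarrow>
  cls w (consC X) \<bullet>\<^bsub>w\<^esub> x \<bullet>\<^bsub>w\<^esub> a \<bullet>\<^bsub>w\<^esub> (cls w (Con SucC) \<bullet>\<^bsub>w\<^esub> n) = a \<bullet>\<^bsub>w\<^esub> n"
  by (subst cls_ev[OF tyf_consC]) (simp add: consC_def)

lemma cat_nil [simp]: "tyof w a = Some (Nat \<rightarrowtail> X) \<Longrightarrow> cls w (catC X) \<bullet>\<^bsub>w\<^esub> cls w (Con (NilC X)) \<bullet>\<^bsub>w\<^esub> a = a"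
  by (subst cls_ev[OF tyf_catC]) (simp add: catC_def)

lemma cat_snoc [simp]:
  "tyof w s = Some (Seq X) \<Longrightarrow> tyof w x = Some X \<Longrightarrow> tyof w a = Some (Nat \<rightarrowtail> X) \<Longrightarrow>
  cls w (catC X) \<bullet>\<^bsub>w\<^esub> (cls w (Con (SnocC X)) \<bullet>\<^bsub>w\<^esub> s \<bullet>\<^bsub>w\<^esub> x) \<bullet>\<^bsub>w\<^esub> a
      = cls w (catC X) \<bullet>\<^bsub>w\<^esub> s \<bullet>\<^bsub>w\<^esub> (cls w (consC X) \<bullet>\<^bsub>w\<^esub> x \<bullet>\<^bsub>w\<^esub> a)"
  by (subst (1 2) cls_ev[OF tyf_catC]) (simp add: catC_def)

lemma init_zero [simp]: "tyof w a = Some (Nat \<rightarrowtail> X) \<Longrightarrow>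
    cls w (initC X) \<bullet>\<^bsub>w\<^esub> a \<bullet>\<^bsub>w\<^esub> cls w (Con ZeroC) = cls w (Con (NilC X))"
  by (subst cls_ev[OF tyf_initC]) (simp add: initC_def)

lemma init_suc [simp]:
  "tyof w a = Some (Nat \<rightarrowtail> X) \<Longrightarrow> tyof w n = Some Nat \<Longrightarrow>
  cls w (initC X) \<bullet>\<^bsub>w\<^esub> a \<bullet>\<^bsub>w\<^esub> (cls w (Con SucC) \<bullet>\<^bsub>w\<^esub> n)
      = cls w (Con (SnocC X)) \<bullet>\<^bsub>w\<^esub> (cls w (initC X) \<bullet>\<^bsub>w\<^esub> a \<bullet>\<^bsub>w\<^esub> n) \<bullet>\<^bsub>w\<^esub> (a \<bullet>\<^bsub>w\<^esub> n)"
  by (subst (1 2) cls_ev[OF tyf_initC]) (simp add: initC_def)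

lemma tail_app [simp]: "tyof w a = Some (Nat \<rightarrowtail> X) \<Longrightarrow> tyof w n = Some Nat \<Longrightarrow>
  cls w (tailC X) \<bullet>\<^bsub>w\<^esub> a \<bullet>\<^bsub>w\<^esub> n = a \<bullet>\<^bsub>w\<^esub> (cls w (Con SucC) \<bullet>\<^bsub>w\<^esub> n)"
  by (subst cls_ev[OF tyf_tailC]) (simp add: tailC_def)

lemma drop_nil [simp]: "tyof w a = Some (Nat \<rightarrowtail> X) \<Longrightarrow>
    cls w (dropC X) \<bullet>\<^bsub>w\<^esub> cls w (Con (NilC X)) \<bullet>\<^bsub>w\<^esub> a = a"
  by (subst cls_ev[OF tyf_dropC]) (simp add: dropC_def)

lemma drop_snoc [simp]:
  "tyof w s = Some (Seq X) \<Longrightarrow> tyof w x = Some X \<Longrightarrow> tyof w a = Some (Nat \<rightarrowtail> X) \<Longrightarrow>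
  cls w (dropC X) \<bullet>\<^bsub>w\<^esub> (cls w (Con (SnocC X)) \<bullet>\<^bsub>w\<^esub> s \<bullet>\<^bsub>w\<^esub> x) \<bullet>\<^bsub>w\<^esub> a
      = cls w (tailC X) \<bullet>\<^bsub>w\<^esub> (cls w (dropC X) \<bullet>\<^bsub>w\<^esub> s \<bullet>\<^bsub>w\<^esub> a)"
  by (subst (1 2) cls_ev[OF tyf_dropC]) (simp add: dropC_def)

lemma fcat_nil [simp]: "tyof w s = Some (Seq X) \<Longrightarrow> cls w (fcatC X) \<bullet>\<^bsub>w\<^esub> s \<bullet>\<^bsub>w\<^esub> cls w (Con (NilC X)) = s"
  by (subst cls_ev[OF tyf_fcatC]) (simp add: fcatC_def)

lemma fcat_snoc [simp]:
  "tyof w s = Some (Seq X) \<Longrightarrow> tyof w x = Some X \<Longrightarrow> tyof w t = Some (Seq X) \<Longrightarrow>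
  cls w (fcatC X) \<bullet>\<^bsub>w\<^esub> t \<bullet>\<^bsub>w\<^esub> (cls w (Con (SnocC X)) \<bullet>\<^bsub>w\<^esub> s \<bullet>\<^bsub>w\<^esub> x)
      = cls w (Con (SnocC X)) \<bullet>\<^bsub>w\<^esub> (cls w (fcatC X) \<bullet>\<^bsub>w\<^esub> t \<bullet>\<^bsub>w\<^esub> s) \<bullet>\<^bsub>w\<^esub> x"
  by (subst (1 2) cls_ev[OF tyf_fcatC]) (simp add: fcatC_def)

lemma lift_simps [simp]:
  "lift k (Var i) = Var (i + k)" "lift k (Con c) = Con c" "lift k (t \<cdot> u) = lift k t \<cdot> lift k u"
  by (simp_all add: lift_def)

section \<open>Induction inside the theory\<close>

lemma nat_ind:
  assumes "wf_fm (Nat # \<Gamma>) A" "\<Gamma> | H \<tturnstile> inst 0 A (Con ZeroC)"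
    "Nat # \<Gamma> | insert A (lift_fm ` H) \<tturnstile> inst 1 A (Con SucC \<cdot> Var 0)"
  shows "\<Gamma> | H \<tturnstile> All Nat A"
  using assms by (meson nat_induct prov_HA ImpE ImpI AllI)

lemma wf_sub_fm: "wf_fm \<Gamma> A \<Longrightarrow> (\<And>i. tyf (env \<Delta>) (\<sigma> i) = env \<Gamma> i) \<Longrightarrow> wf_fm \<Delta> (sub_fm \<sigma> A)"
proof (induction A arbitrary: \<Gamma> \<Delta> \<sigma>)
  case (All T A)
  have "tyf (env (T # \<Delta>)) (sub_up \<sigma> i) = env (T # \<Gamma>) i" for i
    using All.prems(2) by (cases i) (simp_all add: tyf_lift)
  then show ?case using All.IH[of "T # \<Gamma>" "T # \<Delta>" "sub_up \<sigma>"] All.prems(1) by simp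
next
  case (Ex T A)
  have "tyf (env (T # \<Delta>)) (sub_up \<sigma> i) = env (T # \<Gamma>) i" for i
    using Ex.prems(2) by (cases i) (simp_all add: tyf_lift)
  then show ?case using Ex.IH[of "T # \<Gamma>" "T # \<Delta>" "sub_up \<sigma>"] Ex.prems(1) by simp
qed (simp_all add: has_type_iff tyf_sub, blast+)

lemma wf_inst:
  assumes "wf_fm (X # \<Gamma>) A" "tyf (env (\<Delta> @ \<Gamma>)) t = Some X" "k = length \<Delta>"
  shows "wf_fm (\<Delta> @ \<Gamma>) (inst k A t)"
  unfolding inst_def
proof (rule wf_sub_fm[OF assms(1)])
  show "tyf (env (\<Delta> @ \<Gamma>)) (case_nat t (\<lambda>i. Var (i + k)) i) = env (X # \<Gamma>) i" for i
    using assms(2,3) by (cases i) (auto simp: env_def nth_append)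
qed

lemma seq_ind:
  assumes "wf_fm (Seq X # \<Gamma>) A" "\<Gamma> | H \<tturnstile> inst 0 A (Con (NilC X))"
    "X # Seq X # \<Gamma> | insert (inst 2 A (Var 1)) (lift_fm ` lift_fm ` H)
       \<tturnstile> inst 2 A (snoc X (Var 1) (Var 0))"
  shows "\<Gamma> | H \<tturnstile> All (Seq X) A"
  using ImpE[OF ImpE[OF prov_HA[OF seq_induct[OF assms(1)]] assms(2)]]
    AllI[OF AllI[OF ImpI[OF _ assms(3)]]]
    wf_inst[OF assms(1), of "[X, Seq X]" "Var 1" 2] by simp

lemma All_Eq_cls:
  assumes "\<Gamma> | H \<tturnstile> All T (Eq U t u)" "tyof (\<Gamma>, H) a = Some T"
    "tyf (case_nat (Some T) (env \<Gamma>)) t = Some U" "tyf (case_nat (Some T) (env \<Gamma>)) u = Some U"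
  defines "c \<equiv> rep (\<Gamma>, H) a"
  shows "cls (\<Gamma>, H) (sub_tm (case_nat c Var) t) = cls (\<Gamma>, H) (sub_tm (case_nat c Var) u)"
proof -
  have c: "tyf (env \<Gamma>) c = Some T" using assms(2) by (simp add: c_def tyof_def)
  have "\<Gamma> | H \<tturnstile> sub_fm (case_nat c Var) (Eq U t u)"
    by (rule AllE_sub) (use assms(1) c in \<open>simp_all add: has_type_iff sub_up_Var sub_Var\<close>)
  moreover have "(\<lambda>i. tyf (env \<Gamma>) (case_nat c Var i)) = case_nat (Some T) (env \<Gamma>)"
    using c by (auto simp: fun_eq_iff split: nat.split)
  ultimately show ?thesis using assms(3,4)
    by (intro cls_eqI[where T=U]) (simp_all add: has_type_iff tyf_sub)
qed

lemma Eq_cls: "\<Gamma> | H \<tturnstile> Eq U t u \<Longrightarrow> tyf (env \<Gamma>) t = Some U \<Longrightarrow> tyf (env \<Gamma>) u = Some U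
  \<Longrightarrow> cls (\<Gamma>, H) t = cls (\<Gamma>, H) u"
  by (intro cls_eqI) (simp_all add: has_type_iff)

lemma inst_Eq: "inst k (Eq T t u) v =
  Eq T (sub_tm (case_nat v (\<lambda>i. Var (i + k))) t) (sub_tm (case_nat v (\<lambda>i. Var (i + k))) u)"
  by (simp add: inst_def)

lemma tyf_case_nat [simp]: "(\<lambda>i. tyf e (case_nat v \<sigma> i)) = case_nat (tyf e v) (\<lambda>i. tyf e (\<sigma> i))"
  by (rule case_nat_comp)

lemma sub_case_nat: "(\<lambda>i. sub_tm \<sigma> (case_nat v \<tau> i)) = case_nat (sub_tm \<sigma> v) (\<lambda>i. sub_tm \<sigma> (\<tau> i))"
  by (rule case_nat_comp)

text \<open>The induction hypothesis enters the step as an equation between classes, so both cases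
  become rewriting. As the step is stated for every \<open>H\<close>, the hypothesis set produced by
  the rule never has to be written out.\<close>

lemma nat_ind_Eq:
  assumes ty: "tyf (env (Nat # \<Gamma>)) t = Some T" "tyf (env (Nat # \<Gamma>)) u = Some T"
    and base: "cls (\<Gamma>, H) (sub_tm (case_nat (Con ZeroC) Var) t)
        = cls (\<Gamma>, H) (sub_tm (case_nat (Con ZeroC) Var) u)"
    and step: "\<And>H. cls (Nat # \<Gamma>, H) t = cls (Nat # \<Gamma>, H) u \<Longrightarrow>
      cls (Nat # \<Gamma>, H) (sub_tm (case_nat (Con SucC \<cdot> Var 0) (\<lambda>i. Var (Suc i))) t)
      = cls (Nat # \<Gamma>, H) (sub_tm (case_nat (Con SucC \<cdot> Var 0) (\<lambda>i. Var (Suc i))) u)"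
  shows "\<Gamma> | H \<tturnstile> All Nat (Eq T t u)"
proof (rule nat_ind)
  show "wf_fm (Nat # \<Gamma>) (Eq T t u)" using ty by (simp add: has_type_iff)
  show "\<Gamma> | H \<tturnstile> inst 0 (Eq T t u) (Con ZeroC)"
    using base ty by (auto simp: inst_Eq tyf_sub intro!: EqI_cls)
  let ?H = "insert (Eq T t u) (lift_fm ` H)"
  have "Nat # \<Gamma> | ?H \<tturnstile> Eq T t u" using ty by (intro Hyp) (simp_all add: has_type_iff)
  then have "cls (Nat # \<Gamma>, ?H) t = cls (Nat # \<Gamma>, ?H) u" using ty by (rule Eq_cls)
  from step[OF this] show "Nat # \<Gamma> | ?H \<tturnstile> inst 1 (Eq T t u) (Con SucC \<cdot> Var 0)"
    using ty by (auto simp: inst_Eq tyf_sub intro!: EqI_cls)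
qed

lemma sub_up_case: "sub_up (case_nat v (\<lambda>i. Var (f i)))
    = case_nat (Var 0) (case_nat (lift (Suc 0) v) (\<lambda>i. Var (Suc (f i))))"
  by (auto simp: sub_up_def fun_eq_iff split: nat.split)

text \<open>The inner quantifier generalises the hypothesis over a second argument, which is needed
  because \<open>catC\<close> passes from \<open>\<alpha>\<close> to \<open>cons x \<alpha>\<close>.
  In the step, indices 0, 1, 2 are this argument, the appended entry and the shorter
  sequence.\<close>

lemma seq_ind_All_Eq:
  assumes ty: "tyf (env (U # Seq X # \<Gamma>)) t = Some T" "tyf (env (U # Seq X # \<Gamma>)) u = Some T"
    and base: "\<And>H. cls (U # \<Gamma>, H)
        (sub_tm (case_nat (Var 0) (case_nat (Con (NilC X)) (\<lambda>i. Var (Suc i)))) t)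
      = cls (U # \<Gamma>, H) (sub_tm (case_nat (Var 0) (case_nat (Con (NilC X)) (\<lambda>i. Var (Suc i)))) u)"
    and step: "\<And>H w. w = (U # X # Seq X # \<Gamma>, H) \<Longrightarrow> (\<And>a. tyof w a = Some U \<Longrightarrow>
        cls w (sub_tm (case_nat (rep w a) (case_nat (Var 2) (\<lambda>i. Var (Suc (Suc (Suc i)))))) t)
        = cls w (sub_tm (case_nat (rep w a) (case_nat (Var 2) (\<lambda>i. Var (Suc (Suc (Suc i)))))) u)) \<Longrightarrow>
      cls w (sub_tm (case_nat (Var 0)
          (case_nat (snoc X (Var 2) (Var 1)) (\<lambda>i. Var (Suc (Suc (Suc i)))))) t)
      = cls w (sub_tm (case_nat (Var 0)
          (case_nat (snoc X (Var 2) (Var 1)) (\<lambda>i. Var (Suc (Suc (Suc i)))))) u)"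
  shows "\<Gamma> | H \<tturnstile> All (Seq X) (All U (Eq T t u))"
proof (rule seq_ind)
  let ?A = "All U (Eq T t u)"
  show "wf_fm (Seq X # \<Gamma>) ?A" using ty by (simp add: has_type_iff)
  show "\<Gamma> | H \<tturnstile> inst 0 ?A (Con (NilC X))"
    using base ty by (auto simp: inst_def sub_up_case tyf_sub intro!: AllI EqI_cls)
  let ?H = "insert (inst 2 ?A (Var 1)) (lift_fm ` lift_fm ` H)" and ?\<Gamma> = "U # X # Seq X # \<Gamma>"
  let ?w = "(?\<Gamma>, lift_fm ` ?H)"
  let ?\<tau> = "case_nat (Var 0) (case_nat (Var 3) (\<lambda>i. Var (Suc (Suc (Suc (Suc i))))))"
  have "lift_fm (inst 2 ?A (Var 1)) = All U (Eq T (sub_tm ?\<tau> t) (sub_tm ?\<tau> u))"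
    by (simp add: inst_def lift_fm_def sub_fm_sub_fm sub_sub sub_up_case sub_case_nat numeral_3_eq_3)
  then have "?\<Gamma> | lift_fm ` ?H \<tturnstile> All U (Eq T (sub_tm ?\<tau> t) (sub_tm ?\<tau> u))"
    using ty by (intro Hyp) (auto simp add: has_type_iff tyf_sub)
  from All_Eq_cls[OF this] ty
  have "cls ?w (sub_tm (case_nat (rep ?w a) (case_nat (Var 2) (\<lambda>i. Var (Suc (Suc (Suc i)))))) t)
        = cls ?w (sub_tm (case_nat (rep ?w a) (case_nat (Var 2) (\<lambda>i. Var (Suc (Suc (Suc i)))))) u)"
    if "tyof ?w a = Some U" for a
    using that by (simp add: sub_sub sub_case_nat tyf_sub)
  note eq = step[OF refl this]
  let ?\<tau> = "case_nat (Var 0) (case_nat (snoc X (Var 2) (Var 1)) (\<lambda>i. Var (Suc (Suc (Suc i)))))"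
  have "X # Seq X # \<Gamma> | ?H \<tturnstile> All U (Eq T (sub_tm ?\<tau> t) (sub_tm ?\<tau> u))"
  proof (rule AllI, rule EqI_cls, rule eq)
    show "tyf (env ?\<Gamma>) (sub_tm ?\<tau> t) = Some T" using ty by (simp add: tyf_sub)
  qed
  then show "X # Seq X # \<Gamma> | ?H \<tturnstile> inst 2 ?A (snoc X (Var 1) (Var 0))"
    by (simp add: inst_def sub_up_case numeral_2_eq_2)
qed

section \<open>Laws of numbers, sequences and booleans\<close>

lemma tail_cons:
  assumes "tyof w x = Some X" "tyof w a = Some (Nat \<rightarrowtail> X)"
  shows "cls w (tailC X) \<bullet>\<^bsub>w\<^esub> (cls w (consC X) \<bullet>\<^bsub>w\<^esub> x \<bullet>\<^bsub>w\<^esub> a) = a"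
proof -
  let ?t = "rep w x" and ?u = "rep w a"
  have t: "tyf (env (fst w)) ?t = Some X" "tyf (env (fst w)) ?u = Some (Nat \<rightarrowtail> X)"
    using assms by (simp_all add: tyof_def)
  have "cls (fst w, snd w) (tailC X \<cdot> (consC X \<cdot> ?t \<cdot> ?u)) = cls (fst w, snd w) ?u"
    by (rule xi_cls[where T=Nat and U=X]) (use t in \<open>simp_all add: has_type_iff tyf_lift\<close>)
  then show ?thesis using assms by simp
qed

text \<open>\<open>minusC\<close> recurses on its second argument, so this needs internal induction.
  A closed formula is proved in every context and then read at the given element through
  \<open>holds\<close>; the following laws are obtained in the same way.\<close>

lemma minus_zero_left:
  assumes "tyof w n = Some Nat"
  shows "cls w minusC \<bullet>\<^bsub>w\<^esub> cls w (Con ZeroC) \<bullet>\<^bsub>w\<^esub> n = cls w (Con ZeroC)"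
proof -
  have "\<Gamma> | H \<tturnstile> All Nat (Eq Nat (minusC \<cdot> Con ZeroC \<cdot> Var 0) (Con ZeroC))" for \<Gamma> H
    by (rule nat_ind_Eq) (simp_all add: minus_suc)
  from holds_Eq[OF holds_All[OF holds_closed[OF this]]]
  show ?thesis using assms by (simp add: has_type_iff)
qed

lemma minus_suc_suc:
  assumes "tyof w n = Some Nat" "tyof w m = Some Nat"
  shows "cls w minusC \<bullet>\<^bsub>w\<^esub> (cls w (Con SucC) \<bullet>\<^bsub>w\<^esub> n) \<bullet>\<^bsub>w\<^esub> (cls w (Con SucC) \<bullet>\<^bsub>w\<^esub> m)
      = cls w minusC \<bullet>\<^bsub>w\<^esub> n \<bullet>\<^bsub>w\<^esub> m"
proof -
  have "\<Gamma> | H \<tturnstile> All Nat (All Nat (Eq Nat (minusC \<cdot> (Con SucC \<cdot> Var 1) \<cdot> (Con SucC \<cdot> Var 0))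
      (minusC \<cdot> Var 1 \<cdot> Var 0)))" for \<Gamma> H
    by (rule AllI, rule nat_ind_Eq) (simp_all add: minus_suc)
  from holds_Eq[OF holds_All[OF holds_All[OF holds_closed[OF this]]]]
  show ?thesis using assms by (simp add: has_type_iff)
qed

lemma minus_self:
  assumes "tyof w n = Some Nat"
  shows "cls w minusC \<bullet>\<^bsub>w\<^esub> n \<bullet>\<^bsub>w\<^esub> n = cls w (Con ZeroC)"
proof -
  have "\<Gamma> | H \<tturnstile> All Nat (Eq Nat (minusC \<cdot> Var 0 \<cdot> Var 0) (Con ZeroC))" for \<Gamma> H
    by (rule nat_ind_Eq) (simp_all add: minus_suc_suc)
  from holds_Eq[OF holds_All[OF holds_closed[OF this]]]
  show ?thesis using assms by (simp add: has_type_iff)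
qed

lemma len_init:
  assumes "tyof w a = Some (Nat \<rightarrowtail> X)" "tyof w n = Some Nat"
  shows "cls w (lenC X) \<bullet>\<^bsub>w\<^esub> (cls w (initC X) \<bullet>\<^bsub>w\<^esub> a \<bullet>\<^bsub>w\<^esub> n) = n"
proof -
  have "\<Gamma> | H \<tturnstile> All (Nat \<rightarrowtail> X) (All Nat (Eq Nat (lenC X \<cdot> (initC X \<cdot> Var 1 \<cdot> Var 0)) (Var 0)))"
    for \<Gamma> H
    by (rule AllI, rule nat_ind_Eq) simp_all
  from holds_Eq[OF holds_All[OF holds_All[OF holds_closed[OF this]]]]
  show ?thesis using assms by (simp add: has_type_iff)
qed

lemma drop_cat:
  assumes "tyof w s = Some (Seq X)" "tyof w a = Some (Nat \<rightarrowtail> X)"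
  shows "cls w (dropC X) \<bullet>\<^bsub>w\<^esub> s \<bullet>\<^bsub>w\<^esub> (cls w (catC X) \<bullet>\<^bsub>w\<^esub> s \<bullet>\<^bsub>w\<^esub> a) = a"
proof -
  have "\<Gamma> | H \<tturnstile> All (Seq X) (All (Nat \<rightarrowtail> X) (Eq (Nat \<rightarrowtail> X)
      (dropC X \<cdot> Var 1 \<cdot> (catC X \<cdot> Var 1 \<cdot> Var 0)) (Var 0)))" for \<Gamma> H
    by (rule seq_ind_All_Eq) (simp_all add: tail_cons)
  from holds_Eq[OF holds_All[OF holds_All[OF holds_closed[OF this]]]]
  show ?thesis using assms by (simp add: has_type_iff)
qed

lemma cat_fcat:
  assumes "tyof w t = Some (Seq X)" "tyof w s = Some (Seq X)" "tyof w a = Some (Nat \<rightarrowtail> X)"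
  shows "cls w (catC X) \<bullet>\<^bsub>w\<^esub> (cls w (fcatC X) \<bullet>\<^bsub>w\<^esub> t \<bullet>\<^bsub>w\<^esub> s) \<bullet>\<^bsub>w\<^esub> a
    = cls w (catC X) \<bullet>\<^bsub>w\<^esub> t \<bullet>\<^bsub>w\<^esub> (cls w (catC X) \<bullet>\<^bsub>w\<^esub> s \<bullet>\<^bsub>w\<^esub> a)"
proof -
  have "\<Gamma> | H \<tturnstile> All (Seq X) (All (Seq X) (All (Nat \<rightarrowtail> X) (Eq (Nat \<rightarrowtail> X)
    (catC X \<cdot> (fcatC X \<cdot> Var 2 \<cdot> Var 1) \<cdot> Var 0) (catC X \<cdot> Var 2 \<cdot> (catC X \<cdot> Var 1 \<cdot> Var 0)))))"
    for \<Gamma> H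
    by (rule AllI, rule seq_ind_All_Eq) simp_all
  from holds_Eq[OF holds_All[OF holds_All[OF holds_All[OF holds_closed[OF this]]]]]
  show ?thesis using assms by (simp add: has_type_iff)
qed

text \<open>\<open>CondC\<close> sends the two truth values to 1 and 0, which
  \<open>suc_not_zero\<close> separates; the conclusion is any formula, by ex falso.\<close>

lemma true_neq_false:
  assumes "cls (\<Gamma>, H) (Con TrueC) = cls (\<Gamma>, H) (Con FalseC)" "wf_fm \<Gamma> A"
  shows "\<Gamma> | H \<tturnstile> A"
proof (rule BotE[OF _ assms(2)])
  let ?w = "(\<Gamma>, H)" and ?c = "\<lambda>b. Con (CondC Nat) \<cdot> Con b \<cdot> (Con SucC \<cdot> Con ZeroC) \<cdot> Con ZeroC"
  have "cls ?w (?c TrueC) = cls ?w (?c FalseC)" by (simp only: cls_App assms(1))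
  then have "cls ?w (Con SucC \<cdot> Con ZeroC) = cls ?w (Con ZeroC)" by simp
  then have "\<Gamma> | H \<tturnstile> Eq Nat (Con SucC \<cdot> Con ZeroC) (Con ZeroC)" by (rule EqI_cls) simp
  from ImpE[OF prov_HA[OF suc_not_zero] this] show "\<Gamma> | H \<tturnstile> Bot"
    by (simp add: has_type_iff)
qed

text \<open>Being equal to one of the two truth values is proved for a variable by
  \<open>bool_induct\<close> and then instantiated at \<open>b\<close>.\<close>

lemma bool_cases:
  assumes b: "tyf (env \<Gamma>) b = Some Bool" and C: "\<Gamma> | insert (Eq Bool b (Con TrueC)) H \<tturnstile> C"
    "\<Gamma> | insert (Eq Bool b (Con FalseC)) H \<tturnstile> C"
  shows "\<Gamma> | H \<tturnstile> C"
proof (rule OrE[OF _ C])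
  let ?A = "Or (Eq Bool (Var 0) (Con TrueC)) (Eq Bool (Var 0) (Con FalseC))"
  have "\<Gamma> | H \<tturnstile> inst 0 ?A (Con TrueC)"
    by (simp add: inst_def) (intro OrI1 EqI; simp add: has_type_iff)
  moreover have "\<Gamma> | H \<tturnstile> inst 0 ?A (Con FalseC)"
    by (simp add: inst_def) (intro OrI2 EqI; simp add: has_type_iff)
  ultimately have "\<Gamma> | H \<tturnstile> All Bool ?A"
    by (intro ImpE[OF ImpE[OF prov_HA[OF bool_induct]]]) (simp_all add: has_type_iff)
  from AllE[OF this, of b] show "\<Gamma> | H \<tturnstile> Or (Eq Bool b (Con TrueC)) (Eq Bool b (Con FalseC))"
    using b by (simp add: inst_def has_type_iff)
qed

text \<open>A boolean element need not be the class of a truth value, so the case distinction is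
  made in the theory, on a variable.\<close>

lemma fst_cond:
  assumes "tyof w b = Some Bool" "tyof w p = Some (Prod T U)" "tyof w q = Some (Prod T U)"
  shows "cls w (Con (FstC T U)) \<bullet>\<^bsub>w\<^esub> (cls w (Con (CondC (Prod T U))) \<bullet>\<^bsub>w\<^esub> b \<bullet>\<^bsub>w\<^esub> p \<bullet>\<^bsub>w\<^esub> q)
    = cls w (Con (CondC T)) \<bullet>\<^bsub>w\<^esub> b \<bullet>\<^bsub>w\<^esub> (cls w (Con (FstC T U)) \<bullet>\<^bsub>w\<^esub> p) \<bullet>\<^bsub>w\<^esub> (cls w (Con (FstC T U)) \<bullet>\<^bsub>w\<^esub> q)"
proof -
  let ?E = "Eq T (Con (FstC T U) \<cdot> (Con (CondC (Prod T U)) \<cdot> Var 0 \<cdot> Var 1 \<cdot> Var 2))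
    (Con (CondC T) \<cdot> Var 0 \<cdot> (Con (FstC T U) \<cdot> Var 1) \<cdot> (Con (FstC T U) \<cdot> Var 2))"
  have "\<Gamma> | H \<tturnstile> All (Prod T U) (All (Prod T U) (All Bool ?E))" for \<Gamma> H
  proof (rule AllI, rule AllI, rule AllI)
    let ?G = "Bool # Prod T U # Prod T U # \<Gamma>"
    have "?G | H \<tturnstile> ?E" for H
    proof (rule bool_cases[where b="Var 0"])
      have "?G | insert (Eq Bool (Var 0) (Con b)) H \<tturnstile> ?E" if "b = TrueC \<or> b = FalseC" for b
      proof -
        let ?H = "insert (Eq Bool (Var 0) (Con b)) H"
        have "?G | ?H \<tturnstile> Eq Bool (Var 0) (Con b)"
          using that by (intro Hyp) (auto simp: has_type_iff)
        then have "cls (?G, ?H) (Var 0) = cls (?G, ?H) (Con b)"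
          using that by (intro Eq_cls) auto
        then show ?thesis using that by (intro EqI_cls) auto
      qed
      then show "?G | insert (Eq Bool (Var 0) (Con TrueC)) H \<tturnstile> ?E"
        "?G | insert (Eq Bool (Var 0) (Con FalseC)) H \<tturnstile> ?E" by simp_all
    qed simp
    then show "?G | lift_fm ` lift_fm ` lift_fm ` H \<tturnstile> ?E" .
  qed
  from holds_Eq[OF holds_All[OF holds_All[OF holds_All[OF holds_closed[OF this]]]]]
  show ?thesis using assms by (simp add: has_type_iff)
qed

lemma All_Imp_Eq_cls:
  assumes "\<Gamma> | H \<tturnstile> All T (Eq U t u \<rightarrow>\<^sub>f Eq V t' u')" and a: "tyof (\<Gamma>, H) a = Some T"
    and ty: "tyf (case_nat (Some T) (env \<Gamma>)) t = Some U"
      "tyf (case_nat (Some T) (env \<Gamma>)) t' = Some V" "tyf (case_nat (Some T) (env \<Gamma>)) u' = Some V"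
  defines "c \<equiv> rep (\<Gamma>, H) a"
  assumes eq: "cls (\<Gamma>, H) (sub_tm (case_nat c Var) t) = cls (\<Gamma>, H) (sub_tm (case_nat c Var) u)"
  shows "cls (\<Gamma>, H) (sub_tm (case_nat c Var) t') = cls (\<Gamma>, H) (sub_tm (case_nat c Var) u')"
proof -
  have c: "tyf (env \<Gamma>) c = Some T" using a by (simp add: c_def tyof_def)
  have "\<Gamma> | H \<tturnstile> sub_fm (case_nat c Var) (Eq U t u \<rightarrow>\<^sub>f Eq V t' u')"
    by (rule AllE_sub) (use assms(1) c in \<open>simp_all add: has_type_iff sub_up_Var sub_Var\<close>)
  moreover have "\<Gamma> | H \<tturnstile> sub_fm (case_nat c Var) (Eq U t u)"
    using eq ty c by (auto intro!: EqI_cls simp: tyf_sub)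
  ultimately have "\<Gamma> | H \<tturnstile> sub_fm (case_nat c Var) (Eq V t' u')"
    using ImpE by simp
  then show ?thesis using ty c by (intro cls_eqI[where T=V]) (simp_all add: has_type_iff tyf_sub)
qed

text \<open>Spector's condition for a shifted functional yields a comparison with \<open>n\<close>,
  while \<open>BR\<close> compares with the length of \<open>t * [\<alpha>](n)\<close>. Induction on
  \<open>n\<close> for all \<open>a\<close> proves the passage without addition or transitivity of
  the order.\<close>

lemma less_len_fcat:
  assumes "tyof w t = Some (Seq X)" "tyof w \<alpha> = Some (Nat \<rightarrowtail> X)" "tyof w n = Some Nat"
    "tyof w a = Some Nat"
    and "cls w lessC \<bullet>\<^bsub>w\<^esub> a \<bullet>\<^bsub>w\<^esub> n = cls w (Con TrueC)"
  shows "cls w lessC \<bullet>\<^bsub>w\<^esub> a \<bullet>\<^bsub>w\<^esub> (cls w (lenC X)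
      \<bullet>\<^bsub>w\<^esub> (cls w (fcatC X) \<bullet>\<^bsub>w\<^esub> t \<bullet>\<^bsub>w\<^esub> (cls w (initC X) \<bullet>\<^bsub>w\<^esub> \<alpha> \<bullet>\<^bsub>w\<^esub> n))) = cls w (Con TrueC)"
proof -
  let ?f = "\<lambda>a n \<alpha> t. lessC \<cdot> a \<cdot> (lenC X \<cdot> (fcatC X \<cdot> t \<cdot> (initC X \<cdot> \<alpha> \<cdot> n)))"
  let ?F = "\<lambda>a n \<alpha> t. Eq Bool (lessC \<cdot> a \<cdot> n) (Con TrueC) \<rightarrow>\<^sub>f Eq Bool (?f a n \<alpha> t) (Con TrueC)"
  have "\<Gamma> | H \<tturnstile> All (Seq X) (All (Nat \<rightarrowtail> X) (All Nat (All Nat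
      (?F (Var 0) (Var 1) (Var 2) (Var 3)))))" for \<Gamma> H
  proof (rule AllI, rule AllI, rule nat_ind, goal_cases)
    case 1
    show ?case by (simp add: has_type_iff)
  next
    case 2
    let ?H = "lift_fm ` lift_fm ` H" and ?G = "(Nat \<rightarrowtail> X) # Seq X # \<Gamma>"
    have "?G | ?H \<tturnstile> All Nat (?F (Var 0) (Con ZeroC) (Var 1) (Var 2))"
    proof (rule AllI, rule ImpI)
      let ?G = "Nat # ?G" and ?H = "insert (Eq Bool (lessC \<cdot> Var 0 \<cdot> Con ZeroC) (Con TrueC))
          (lift_fm ` ?H)"
      have "?G | ?H \<tturnstile> Eq Bool (lessC \<cdot> Var 0 \<cdot> Con ZeroC) (Con TrueC)"
        by (rule Hyp) (simp_all add: has_type_iff)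
      then have "cls (?G, ?H) (lessC \<cdot> Var 0 \<cdot> Con ZeroC) = cls (?G, ?H) (Con TrueC)"
        by (rule Eq_cls) simp_all
      then show "?G | ?H \<tturnstile> Eq Bool (?f (Var 0) (Con ZeroC) (Var 1) (Var 2)) (Con TrueC)"
        by (intro true_neq_false) (simp_all add: less_pos minus_zero_left has_type_iff)
    qed (simp add: has_type_iff)
    then show ?case by (simp add: inst_def numeral_eq_Suc)
  next
    case 3
    let ?G = "Nat # (Nat \<rightarrowtail> X) # Seq X # \<Gamma>"
      and ?H = "insert (All Nat (?F (Var 0) (Var 1) (Var 2) (Var 3)))
          (lift_fm ` lift_fm ` lift_fm ` H)"
    \<comment> \<open>A case distinction on \<open>a\<close>: for 0 the length on the right is a
      successor; for a successor both comparisons lose one, and the hypothesis on \<open>n\<close>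
      applies to the predecessor.\<close>
    have "?G | ?H \<tturnstile> All Nat (?F (Var 0) (Con SucC \<cdot> Var 1) (Var 2) (Var 3))"
    proof (rule nat_ind, goal_cases)
      case 1
      show ?case by (simp add: has_type_iff)
    next
      case 2
      have "?G | insert (Eq Bool (lessC \<cdot> Con ZeroC \<cdot> (Con SucC \<cdot> Var 0)) (Con TrueC)) ?H \<tturnstile>
          Eq Bool (?f (Con ZeroC) (Con SucC \<cdot> Var 0) (Var 1) (Var 2)) (Con TrueC)"
        by (rule EqI_cls) (simp_all add: less_pos)
      then have "?G | ?H \<tturnstile> ?F (Con ZeroC) (Con SucC \<cdot> Var 0) (Var 1) (Var 2)"
        by (rule ImpI[rotated]) (simp add: has_type_iff)
      then show ?case by (simp add: inst_def numeral_eq_Suc)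
    next
      case 3
      let ?H = "insert (?F (Var 0) (Con SucC \<cdot> Var 1) (Var 2) (Var 3)) (lift_fm ` ?H)"
        and ?G = "Nat # ?G"
      have "?G | ?H \<tturnstile> ?F (Con SucC \<cdot> Var 0) (Con SucC \<cdot> Var 1) (Var 2) (Var 3)"
      proof (rule ImpI)
        let ?H = "insert (Eq Bool (lessC \<cdot> (Con SucC \<cdot> Var 0) \<cdot> (Con SucC \<cdot> Var 1)) (Con TrueC)) ?H"
        have "?G | ?H \<tturnstile> Eq Bool (lessC \<cdot> (Con SucC \<cdot> Var 0) \<cdot> (Con SucC \<cdot> Var 1)) (Con TrueC)"
          by (rule Hyp) (simp_all add: has_type_iff)
        then have 1: "cls (?G, ?H) (lessC \<cdot> (Con SucC \<cdot> Var 0) \<cdot> (Con SucC \<cdot> Var 1))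
            = cls (?G, ?H) (Con TrueC)"
          by (rule Eq_cls) simp_all
        have "?G | ?H \<tturnstile> All Nat (?F (Var 0) (Var 2) (Var 3) (Var 4))"
          by (rule Hyp) (simp_all add: has_type_iff lift_fm_def)
        from All_Imp_Eq_cls[OF this, of "cls (?G, ?H) (Var 0)"] 1
        show "?G | ?H \<tturnstile> Eq Bool (?f (Con SucC \<cdot> Var 0) (Con SucC \<cdot> Var 1) (Var 2) (Var 3))
            (Con TrueC)"
          by (intro EqI_cls) (simp_all add: less_pos minus_suc_suc)
      qed (simp add: has_type_iff)
      then show ?case by (simp add: inst_def numeral_eq_Suc)
    qed
    then show ?case by (simp add: inst_def numeral_eq_Suc)
  qed
  from holds_Eq[OF holds_Imp_Eq[OF holds_All[OF holds_All[OF holds_All[OF holds_All[OF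
      holds_closed[OF this]]]]]]]
  show ?thesis using assms by (simp add: has_type_iff)
qed

section \<open>Bar recursion in the term model\<close>

text \<open>An opaque name for the equation: substitutions pass to \<open>B\<close> by
  \<open>sub_BRF\<close> and the formula stays folded when it is used as a hypothesis.\<close>

definition BRF :: "ty \<Rightarrow> ty \<Rightarrow> tm \<Rightarrow> fm" where
  "BRF X R B = fn_eqn BR (X, R) B"

lemma lift_4: "lift 4 t = lift (Suc 0) (lift (Suc 0) (lift (Suc 0) (lift (Suc 0) t)))"
  by (simp add: lift_def ren_ren eval_nat_numeral)

lemma sub_BR_eqn: "sub_fm \<sigma> (BR_eqn X R B \<omega> s \<phi> q)
  = BR_eqn X R (sub_tm \<sigma> B) (sub_tm \<sigma> \<omega>) (sub_tm \<sigma> s) (sub_tm \<sigma> \<phi>) (sub_tm \<sigma> q)"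
  by (simp add: BR_eqn_def sect_def sub_up_lift)

lemma sub_BRF [simp]: "sub_fm \<sigma> (BRF X R B) = BRF X R (sub_tm \<sigma> B)"
  by (simp add: BRF_def BR_def sub_BR_eqn lift_4 sub_up_lift numeral_2_eq_2 numeral_3_eq_3)

lemma wf_BRF [simp]: "tyf (env \<Gamma>) B = Some (BR_ty (X, R)) \<Longrightarrow> wf_fm \<Gamma> (BRF X R B)"
  by (simp add: BRF_def BR_def BR_eqn_def sect_def lift_4 has_type_iff tyf_lift BR_ty_def)

text \<open>A closed version of the abstraction in the recursive call of \<open>BR\<close>, so that elements can be
  substituted into it.\<close>

definition nextC :: "ty \<Rightarrow> ty \<Rightarrow> tm" where
  "nextC X R = Lam (BR_ty (X, R)) (Lam ((Nat \<rightarrowtail> X) \<rightarrowtail> Nat) (Lam (Seq X) (Lam (Seq X \<rightarrowtail> K_ty R X)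
     (Lam ((Nat \<rightarrowtail> X) \<rightarrowtail> R) (Lam X (Var 5 \<cdot> Var 4 \<cdot> snoc X (Var 3) (Var 0) \<cdot> Var 2 \<cdot> Var 1))))))"

lemma tyf_nextC [simp]: "tyf e (nextC X R) = Some (BR_ty (X, R) \<rightarrowtail> ((Nat \<rightarrowtail> X) \<rightarrowtail> Nat)
  \<rightarrowtail> Seq X \<rightarrowtail> (Seq X \<rightarrowtail> K_ty R X) \<rightarrowtail> ((Nat \<rightarrowtail> X) \<rightarrowtail> R) \<rightarrowtail> X \<rightarrowtail> R)"
  by (simp add: nextC_def BR_ty_def)

lemmas closed_nextC [simp] = closed_simps[OF tyf_nextC]

lemma sub_case_lift_Var: "sub_tm (case_nat u Var) (lift (Suc 0) t) = t"
  by (simp add: sub_case_lift sub_Var)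

declare BR_ty_def [simp]

text \<open>Identifies a literal abstraction with a term built from closed operations by comparing
  its body with that term at the bound variable.\<close>

lemma cls_LamI:
  assumes b: "tyf (case_nat (Some T) (env \<Gamma>)) b = Some U" and g: "tyf (env \<Gamma>) g = Some (T \<rightarrowtail> U)"
    and eq: "cls (T # \<Gamma>, lift_fm ` H) b = cls (T # \<Gamma>, lift_fm ` H) (lift (Suc 0) g \<cdot> Var 0)"
  shows "cls (\<Gamma>, H) (Lam T b) = cls (\<Gamma>, H) g"
proof (rule xi_cls[where T=T and U=U])
  \<comment> \<open>Weakening shifts all indices of the body except the bound one; beta at
    \<open>Var 0\<close> then returns \<open>b\<close>.\<close>
  let ?b = "ren_tm (ren_up Suc) b"
  have "(\<lambda>i. case_nat (Some T) (case_nat (Some T) (env \<Gamma>)) (ren_up Suc i))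
      = case_nat (Some T) (env \<Gamma>)"
    by (auto simp: ren_up_def fun_eq_iff split: nat.split)
  then have "tyf (case_nat (Some T) (case_nat (Some T) (env \<Gamma>))) ?b = Some U"
    using b by (simp add: tyf_ren)
  moreover have "(\<lambda>i. case_nat (Var 0) Var (ren_up Suc i)) = Var"
    by (auto simp: ren_up_def fun_eq_iff split: nat.split)
  then have "sub_tm (case_nat (Var 0) Var) ?b = b" by (simp add: sub_ren sub_Var)
  ultimately show "cls (T # \<Gamma>, lift_fm ` H) (lift 1 (Lam T b) \<cdot> Var 0)
      = cls (T # \<Gamma>, lift_fm ` H) (lift 1 g \<cdot> Var 0)"
    using eq by (simp add: lift_def)
qed (use b g in \<open>simp_all add: has_type_iff\<close>)

lemma next_app [simp]:
  assumes "tyof w b = Some (BR_ty (X, R))" "tyof w \<omega> = Some ((Nat \<rightarrowtail> X) \<rightarrowtail> Nat)" "tyof w s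
      = Some (Seq X)"
    "tyof w \<phi> = Some (Seq X \<rightarrowtail> K_ty R X)" "tyof w q = Some ((Nat \<rightarrowtail> X) \<rightarrowtail> R)" "tyof w x = Some X"
  shows "cls w (nextC X R) \<bullet>\<^bsub>w\<^esub> b \<bullet>\<^bsub>w\<^esub> \<omega> \<bullet>\<^bsub>w\<^esub> s \<bullet>\<^bsub>w\<^esub> \<phi> \<bullet>\<^bsub>w\<^esub> q \<bullet>\<^bsub>w\<^esub> x
    = b \<bullet>\<^bsub>w\<^esub> \<omega> \<bullet>\<^bsub>w\<^esub> (cls w (Con (SnocC X)) \<bullet>\<^bsub>w\<^esub> s \<bullet>\<^bsub>w\<^esub> x) \<bullet>\<^bsub>w\<^esub> \<phi> \<bullet>\<^bsub>w\<^esub> q"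
  by (subst cls_ev[OF tyf_nextC]) (use assms in \<open>simp add: nextC_def\<close>)

lemma BR_rule:
  assumes BR: "\<Gamma> | H \<tturnstile> BRF X R B" "tyf (env \<Gamma>) B = Some (BR_ty (X, R))"
    and \<omega>: "tyof (\<Gamma>, H) \<omega> = Some ((Nat \<rightarrowtail> X) \<rightarrowtail> Nat)" and s: "tyof (\<Gamma>, H) s = Some (Seq X)"
    and \<phi>: "tyof (\<Gamma>, H) \<phi> = Some (Seq X \<rightarrowtail> K_ty R X)" and q: "tyof (\<Gamma>, H) q = Some ((Nat \<rightarrowtail> X) \<rightarrowtail> R)"
  defines "w \<equiv> (\<Gamma>, H)"
  shows "cls w B \<bullet>\<^bsub>w\<^esub> \<omega> \<bullet>\<^bsub>w\<^esub> s \<bullet>\<^bsub>w\<^esub> \<phi> \<bullet>\<^bsub>w\<^esub> q =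
    cls w (Con (CondC R))
      \<bullet>\<^bsub>w\<^esub> (cls w lessC \<bullet>\<^bsub>w\<^esub> (\<omega> \<bullet>\<^bsub>w\<^esub> (cls w (catC X) \<bullet>\<^bsub>w\<^esub> s \<bullet>\<^bsub>w\<^esub> cls w (zero (Nat \<rightarrowtail> X)))) \<bullet>\<^bsub>w\<^esub> (cls w (lenC X) \<bullet>\<^bsub>w\<^esub> s))
      \<bullet>\<^bsub>w\<^esub> (q \<bullet>\<^bsub>w\<^esub> (cls w (catC X) \<bullet>\<^bsub>w\<^esub> s \<bullet>\<^bsub>w\<^esub> cls w (zero (Nat \<rightarrowtail> X))))
      \<bullet>\<^bsub>w\<^esub> (\<phi> \<bullet>\<^bsub>w\<^esub> s \<bullet>\<^bsub>w\<^esub> (cls w (nextC X R) \<bullet>\<^bsub>w\<^esub> cls w B \<bullet>\<^bsub>w\<^esub> \<omega> \<bullet>\<^bsub>w\<^esub> s \<bullet>\<^bsub>w\<^esub> \<phi> \<bullet>\<^bsub>w\<^esub> q))"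
proof -
  let ?o = "rep w \<omega>" and ?s = "rep w s" and ?f = "rep w \<phi>" and ?q = "rep w q"
  have ty: "tyf (env \<Gamma>) ?o = Some ((Nat \<rightarrowtail> X) \<rightarrowtail> Nat)" "tyf (env \<Gamma>) ?s = Some (Seq X)"
    "tyf (env \<Gamma>) ?f = Some (Seq X \<rightarrowtail> K_ty R X)" "tyf (env \<Gamma>) ?q = Some ((Nat \<rightarrowtail> X) \<rightarrowtail> R)"
    using \<omega> s \<phi> q by (simp_all add: w_def tyof_def)
  note ty' = ty[folded has_type_iff]
  \<comment> \<open>The identity substitution is inserted so that \<open>AllE_sub\<close> can
    collect the four arguments in it.\<close>
  have "\<Gamma> | H \<tturnstile> sub_fm Var (BRF X R B)" using BR(1) by (simp add: sub_Var)
  from this[unfolded BRF_def BR_def, simplified]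
  have "\<Gamma> | H \<tturnstile> sub_fm (case_nat ?q (case_nat ?f (case_nat ?s (case_nat ?o Var))))
     (BR_eqn X R (lift 4 B) (Var 3) (Var 2) (Var 1) (Var 0))"
    using ty' by (intro AllE_sub) (simp_all add: sub_up_Var)
  then have E: "\<Gamma> | H \<tturnstile> BR_eqn X R B ?o ?s ?f ?q"
    by (simp add: sub_BR_eqn lift_4 sub_case_lift sub_Var)
  let ?L = "Lam X (lift 1 B \<cdot> lift 1 ?o \<cdot> snoc X (lift 1 ?s) (Var 0) \<cdot> lift 1 ?f \<cdot> lift 1 ?q)"
  let ?N = "nextC X R \<cdot> B \<cdot> ?o \<cdot> ?s \<cdot> ?f \<cdot> ?q"
  have L: "cls w ?L = cls w ?N" unfolding w_def
    by (rule cls_LamI[where U=R]) (use ty BR(2) in \<open>simp_all add: tyf_lift w_def\<close>)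
  from E have "cls w (B \<cdot> ?o \<cdot> ?s \<cdot> ?f \<cdot> ?q) = cls w
     (Con (CondC R) \<cdot> (lessC \<cdot> (sect X ?o ?s \<cdot> zero (Nat \<rightarrowtail> X)) \<cdot> (lenC X \<cdot> ?s))
          \<cdot> (sect X ?q ?s \<cdot> zero (Nat \<rightarrowtail> X)) \<cdot> (?f \<cdot> ?s \<cdot> ?L))"
    unfolding BR_eqn_def w_def
    by (intro Eq_cls) (use ty BR(2) in \<open>simp_all add: sect_def tyf_lift w_def\<close>)
  then show ?thesis using ty L assms(2-6)
    by (simp add: w_def sect_def tyf_lift sub_case_lift_Var)
qed

section \<open>Spector's condition\<close>

text \<open>\<open>kreiselC X R\<close> applied to \<open>B\<close>, \<open>\<omega>\<close>, \<open>\<alpha>\<close>, \<open>k\<close> is the number \<open>K k\<close> of steps from \<open>[\<alpha>](k)\<close> to a stopping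
  point: \<open>K k = K (k + 1) + 1\<close> unless \<open>\<omega> ([\<alpha>](k) * 0) < k\<close>.\<close>

definition kreisel_phiC :: "ty \<Rightarrow> ty \<Rightarrow> tm" where
  "kreisel_phiC X R = Lam (Nat \<rightarrowtail> X) (Lam (Seq X) (Lam (X \<rightarrowtail> Prod R Nat)
     (Con (PairC R Nat) \<cdot> zero R
        \<cdot> (Con SucC \<cdot> (Con (SndC R Nat) \<cdot> (Var 0 \<cdot> (Var 2 \<cdot> (lenC X \<cdot> Var 1))))))))"

definition kreiselC :: "ty \<Rightarrow> ty \<Rightarrow> tm" where
  "kreiselC X R = Lam (BR_ty (X, Prod R Nat)) (Lam ((Nat \<rightarrowtail> X) \<rightarrowtail> Nat) (Lam (Nat \<rightarrowtail> X) (Lam Nat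
     (Con (SndC R Nat) \<cdot> (Var 3 \<cdot> Var 2 \<cdot> (initC X \<cdot> Var 1 \<cdot> Var 0) \<cdot> (kreisel_phiC X R \<cdot> Var 1)
        \<cdot> zero ((Nat \<rightarrowtail> X) \<rightarrowtail> Prod R Nat))))))"

text \<open>Compares with \<open>n\<close> itself; \<open>len_init\<close> translates this into the
  test against the length of \<open>[\<alpha>](n)\<close> in the equation of
  \<open>BR\<close>.\<close>

definition stopC :: "ty \<Rightarrow> tm" where
  "stopC X = Lam ((Nat \<rightarrowtail> X) \<rightarrowtail> Nat) (Lam (Nat \<rightarrowtail> X) (Lam Nat
     (lessC \<cdot> (Var 2 \<cdot> (catC X \<cdot> (initC X \<cdot> Var 1 \<cdot> Var 0) \<cdot> zero (Nat \<rightarrowtail> X))) \<cdot> Var 0)))"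

lemma tyf_kreisel_phiC [simp]:
  "tyf e (kreisel_phiC X R) = Some ((Nat \<rightarrowtail> X) \<rightarrowtail> Seq X \<rightarrowtail> K_ty (Prod R Nat) X)"
  by (simp add: kreisel_phiC_def)

lemmas closed_kreisel_phiC [simp] = closed_simps[OF tyf_kreisel_phiC]

lemma tyf_kreiselC [simp]:
  "tyf e (kreiselC X R) = Some (BR_ty (X, Prod R Nat) \<rightarrowtail> ((Nat \<rightarrowtail> X) \<rightarrowtail> Nat) \<rightarrowtail> (Nat \<rightarrowtail> X) \<rightarrowtail> Nat \<rightarrowtail> Nat)"
  by (simp add: kreiselC_def)

lemma tyf_stopC [simp]:
  "tyf e (stopC X) = Some (((Nat \<rightarrowtail> X) \<rightarrowtail> Nat) \<rightarrowtail> (Nat \<rightarrowtail> X) \<rightarrowtail> Nat \<rightarrowtail> Bool)"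
  by (simp add: stopC_def)

lemmas closed_kreisel [simp] = closed_simps[OF tyf_kreiselC] closed_simps[OF tyf_stopC]

lemma zero_app: "tyof w a = Some T \<Longrightarrow> cls w (zero (T \<rightarrowtail> U)) \<bullet>\<^bsub>w\<^esub> a = cls w (zero U)"
  by (subst cls_ev[OF tyf_zero]) (simp add: zero.simps)

lemma kreisel_phi:
  assumes "tyof w a = Some (Nat \<rightarrowtail> X)" "tyof w s = Some (Seq X)" "tyof w p = Some (X \<rightarrowtail> Prod R Nat)"
  shows "cls w (kreisel_phiC X R) \<bullet>\<^bsub>w\<^esub> a \<bullet>\<^bsub>w\<^esub> s \<bullet>\<^bsub>w\<^esub> p
      = cls w (Con (PairC R Nat)) \<bullet>\<^bsub>w\<^esub> cls w (zero R) \<bullet>\<^bsub>w\<^esub> (cls w (Con SucC)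
      \<bullet>\<^bsub>w\<^esub> (cls w (Con (SndC R Nat)) \<bullet>\<^bsub>w\<^esub> (p \<bullet>\<^bsub>w\<^esub> (a \<bullet>\<^bsub>w\<^esub> (cls w (lenC X) \<bullet>\<^bsub>w\<^esub> s)))))"
  by (subst cls_ev[OF tyf_kreisel_phiC]) (use assms in \<open>simp add: kreisel_phiC_def\<close>)

lemma kreisel_app:
  assumes "tyof w b = Some (BR_ty (X, Prod R Nat))" "tyof w \<omega> = Some ((Nat \<rightarrowtail> X) \<rightarrowtail> Nat)"
    "tyof w a = Some (Nat \<rightarrowtail> X)" "tyof w n = Some Nat"
  shows "cls w (kreiselC X R) \<bullet>\<^bsub>w\<^esub> b \<bullet>\<^bsub>w\<^esub> \<omega> \<bullet>\<^bsub>w\<^esub> a \<bullet>\<^bsub>w\<^esub> n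
      = cls w (Con (SndC R Nat)) \<bullet>\<^bsub>w\<^esub> (b \<bullet>\<^bsub>w\<^esub> \<omega> \<bullet>\<^bsub>w\<^esub> (cls w (initC X) \<bullet>\<^bsub>w\<^esub> a \<bullet>\<^bsub>w\<^esub> n)
      \<bullet>\<^bsub>w\<^esub> (cls w (kreisel_phiC X R) \<bullet>\<^bsub>w\<^esub> a) \<bullet>\<^bsub>w\<^esub> cls w (zero ((Nat \<rightarrowtail> X) \<rightarrowtail> Prod R Nat)))"
  by (subst cls_ev[OF tyf_kreiselC]) (use assms in \<open>simp add: kreiselC_def\<close>)

lemma stop_app:
  assumes "tyof w \<omega> = Some ((Nat \<rightarrowtail> X) \<rightarrowtail> Nat)" "tyof w a = Some (Nat \<rightarrowtail> X)" "tyof w n = Some Nat"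
  shows "cls w (stopC X) \<bullet>\<^bsub>w\<^esub> \<omega> \<bullet>\<^bsub>w\<^esub> a \<bullet>\<^bsub>w\<^esub> n
    = cls w lessC \<bullet>\<^bsub>w\<^esub> (\<omega> \<bullet>\<^bsub>w\<^esub> (cls w (catC X) \<bullet>\<^bsub>w\<^esub> (cls w (initC X) \<bullet>\<^bsub>w\<^esub> a \<bullet>\<^bsub>w\<^esub> n)
        \<bullet>\<^bsub>w\<^esub> cls w (zero (Nat \<rightarrowtail> X)))) \<bullet>\<^bsub>w\<^esub> n"
  by (subst cls_ev[OF tyf_stopC]) (use assms in \<open>simp add: stopC_def\<close>)

text \<open>When the test fails, the equation of \<open>BR\<close> calls the counting functional,
  which follows \<alpha> because the length of \<open>[\<alpha>](n)\<close> is \<open>n\<close>, and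
  adds one to the second component.\<close>

lemma kreisel_suc:
  assumes BR: "\<Gamma> | H \<tturnstile> BRF X (Prod R Nat) B" "tyf (env \<Gamma>) B = Some (BR_ty (X, Prod R Nat))"
  defines "w \<equiv> (\<Gamma>, H)" and "b \<equiv> cls (\<Gamma>, H) B"
  assumes ty: "tyof w \<omega> = Some ((Nat \<rightarrowtail> X) \<rightarrowtail> Nat)" "tyof w a = Some (Nat \<rightarrowtail> X)" "tyof w n = Some Nat"
    and stop: "cls w (stopC X) \<bullet>\<^bsub>w\<^esub> \<omega> \<bullet>\<^bsub>w\<^esub> a \<bullet>\<^bsub>w\<^esub> n = cls w (Con FalseC)"
  shows "cls w (kreiselC X R) \<bullet>\<^bsub>w\<^esub> b \<bullet>\<^bsub>w\<^esub> \<omega> \<bullet>\<^bsub>w\<^esub> a \<bullet>\<^bsub>w\<^esub> n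
      = cls w (Con SucC) \<bullet>\<^bsub>w\<^esub> (cls w (kreiselC X R) \<bullet>\<^bsub>w\<^esub> b \<bullet>\<^bsub>w\<^esub> \<omega> \<bullet>\<^bsub>w\<^esub> a \<bullet>\<^bsub>w\<^esub> (cls w (Con SucC) \<bullet>\<^bsub>w\<^esub> n))"
proof -
  have b: "tyof w b = Some (BR_ty (X, Prod R Nat))" using BR(2) by (simp add: w_def b_def)
  let ?s = "cls w (initC X) \<bullet>\<^bsub>w\<^esub> a \<bullet>\<^bsub>w\<^esub> n"
  have "cls w lessC \<bullet>\<^bsub>w\<^esub> (\<omega> \<bullet>\<^bsub>w\<^esub> (cls w (catC X) \<bullet>\<^bsub>w\<^esub> ?s \<bullet>\<^bsub>w\<^esub> cls w (zero (Nat \<rightarrowtail> X))))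
      \<bullet>\<^bsub>w\<^esub> (cls w (lenC X) \<bullet>\<^bsub>w\<^esub> ?s) = cls w (Con FalseC)"
    using stop ty by (simp add: stop_app len_init)
  then show ?thesis
    using b ty BR_rule[OF BR, folded w_def b_def, of \<omega> ?s "cls w (kreisel_phiC X R) \<bullet>\<^bsub>w\<^esub> a"
       "cls w (zero ((Nat \<rightarrowtail> X) \<rightarrowtail> Prod R Nat))"]
    by (simp add: kreisel_app kreisel_phi zero_app len_init)
qed

text \<open>Existence of a stopping point is not decidable intuitionistically, hence the disjunction
  in the induction; the test at a single \<open>k\<close> is boolean and can be split. Indices 2, 1,
  0 of \<open>G\<close> are the bar recursor, \<omega> and \<alpha>.\<close>

lemma spector_core:
  fixes X R \<Gamma>
  defines "G \<equiv> (Nat \<rightarrowtail> X) # ((Nat \<rightarrowtail> X) \<rightarrowtail> Nat) # BR_ty (X, Prod R Nat) # \<Gamma>"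
  assumes BR: "BRF X (Prod R Nat) (Var 2) \<in> H"
  shows "G | H \<tturnstile> Ex Nat (Eq Bool (stopC X \<cdot> Var 2 \<cdot> Var 1 \<cdot> Var 0) (Con TrueC))"
proof -
  let ?stop = "\<lambda>\<omega> a n. stopC X \<cdot> Var \<omega> \<cdot> Var a \<cdot> n"
    and ?K = "\<lambda>B \<omega> a n. kreiselC X R \<cdot> Var B \<cdot> Var \<omega> \<cdot> Var a \<cdot> n"
  let ?Q = "\<lambda>\<omega> a n. Eq Bool (?stop \<omega> a n) (Con TrueC)"
  \<comment> \<open>\<open>k\<close> counts the binders on top of \<open>G\<close>: 0 outside the
    induction, 1 under its variable.\<close>
  let ?E = "\<lambda>k. Ex Nat (?Q (2 + k) (1 + k) (Var 0))"
  let ?D = "\<lambda>k n. Eq Nat (minusC \<cdot> ?K (2 + k) (1 + k) k (Con ZeroC) \<cdot> n) (?K (2 + k) (1 + k) k n)"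
  have wf: "wf_fm G (?E 0)" "wf_fm (Nat # G) (?E 1)" "wf_fm (Nat # G) (?D 1 (Var 0))"
    by (simp_all add: G_def has_type_iff)
  \<comment> \<open>\<open>K 0 - k = K k\<close> as long as there is no stopping point; for \<open>k = K 0\<close> this gives \<open>K k = 0\<close>, so that
    \<open>k\<close> is a stopping point.\<close>
  have "G | H \<tturnstile> All Nat (Or (?E 1) (?D 1 (Var 0)))"
  proof (rule nat_ind)
    show "wf_fm (Nat # G) (Or (?E 1) (?D 1 (Var 0)))" using wf by simp
    have "G | H \<tturnstile> ?D 0 (Con ZeroC)"
      by (rule EqI_cls) (simp_all add: G_def)
    then have "G | H \<tturnstile> Or (?E 0) (?D 0 (Con ZeroC))" by (rule OrI2[OF wf(1)])
    then show "G | H \<tturnstile> inst 0 (Or (?E 1) (?D 1 (Var 0))) (Con ZeroC)"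
      by (simp add: inst_def numeral_eq_Suc)
    let ?G = "Nat # G" and ?H = "insert (Or (?E 1) (?D 1 (Var 0))) (lift_fm ` H)"
    have "?G | ?H \<tturnstile> Or (?E 1) (?D 1 (Con SucC \<cdot> Var 0))"
    proof (rule OrE)
      show "?G | ?H \<tturnstile> Or (?E 1) (?D 1 (Var 0))"
        by (rule Hyp) (use wf in simp_all)
      show "?G | insert (?E 1) ?H \<tturnstile> Or (?E 1) (?D 1 (Con SucC \<cdot> Var 0))"
        by (rule OrI1, rule Hyp) (simp_all add: G_def has_type_iff)
      let ?H = "insert (?D 1 (Var 0)) ?H"
      show "?G | ?H \<tturnstile> Or (?E 1) (?D 1 (Con SucC \<cdot> Var 0))"
      proof (rule bool_cases)
        show "tyf (env ?G) (?stop 2 1 (Var 0)) = Some Bool" by (simp add: G_def)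
        let ?HT = "insert (Eq Bool (?stop 2 1 (Var 0)) (Con TrueC)) ?H"
        have "?G | ?HT \<tturnstile> inst 0 (?Q 3 2 (Var 0)) (Var 0)"
          by (rule Hyp) (simp_all add: inst_def numeral_eq_Suc G_def has_type_iff)
        then have "?G | ?HT \<tturnstile> Ex Nat (?Q 3 2 (Var 0))"
          by (rule ExI[rotated 2]) (simp_all add: G_def has_type_iff)
        then show "?G | ?HT \<tturnstile> Or (?E 1) (?D 1 (Con SucC \<cdot> Var 0))"
          by (intro OrI1) (simp_all add: G_def has_type_iff numeral_eq_Suc)
        let ?H = "insert (Eq Bool (?stop 2 1 (Var 0)) (Con FalseC)) ?H"
        let ?w = "(?G, ?H)"
        have F: "cls ?w (?stop 2 1 (Var 0)) = cls ?w (Con FalseC)"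
          by (rule Eq_cls, rule Hyp) (simp_all add: G_def has_type_iff)
        have D: "cls ?w (minusC \<cdot> ?K 3 2 1 (Con ZeroC) \<cdot> Var 0) = cls ?w (?K 3 2 1 (Var 0))"
          by (rule Eq_cls, rule Hyp) (simp_all add: G_def has_type_iff numeral_eq_Suc)
        have "lift_fm (BRF X (Prod R Nat) (Var 2)) \<in> ?H" using BR by blast
        then have "?G | ?H \<tturnstile> BRF X (Prod R Nat) (Var 3)"
          by (intro Hyp) (simp_all add: lift_fm_def G_def)
        from kreisel_suc[OF this, of "cls ?w (Var 2)" "cls ?w (Var 1)" "cls ?w (Var 0)"] F
        have "cls ?w (?K 3 2 1 (Var 0)) = cls ?w (Con SucC \<cdot> ?K 3 2 1 (Con SucC \<cdot> Var 0))"
          by (simp add: G_def)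
        \<comment> \<open>Truncated subtraction suffices: \<open>K 0 - (k + 1)\<close> is the
          predecessor of \<open>K 0 - k = K k = K (k + 1) + 1\<close>.\<close>
        with D have "?G | ?H \<tturnstile> Eq Nat (minusC \<cdot> ?K 3 2 1 (Con ZeroC) \<cdot> (Con SucC \<cdot> Var 0))
            (?K 3 2 1 (Con SucC \<cdot> Var 0))"
          by (intro EqI_cls) (simp_all add: G_def minus_suc)
        then show "?G | ?H \<tturnstile> Or (?E 1) (?D 1 (Con SucC \<cdot> Var 0))"
          by (intro OrI2) (simp_all add: G_def has_type_iff numeral_eq_Suc)
      qed
    qed
    then show "?G | ?H \<tturnstile> inst 1 (Or (?E 1) (?D 1 (Var 0))) (Con SucC \<cdot> Var 0)"
      by (simp add: inst_def numeral_eq_Suc)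
  qed
  from AllE[OF this, of "?K 2 1 0 (Con ZeroC)"]
  have or: "G | H \<tturnstile> Or (?E 0) (?D 0 (?K 2 1 0 (Con ZeroC)))"
    by (simp add: inst_def numeral_eq_Suc G_def has_type_iff)
  let ?n = "?K 2 1 0 (Con ZeroC)"
  have "G | H \<tturnstile> ?E 0"
  proof (rule OrE[OF or])
    show "G | insert (?E 0) H \<tturnstile> ?E 0"
      by (rule Hyp) (simp_all add: G_def has_type_iff)
    let ?H = "insert (?D 0 ?n) H"
    show "G | ?H \<tturnstile> ?E 0"
    proof (rule bool_cases)
      show "tyf (env G) (?stop 1 0 ?n) = Some Bool" by (simp add: G_def)
      let ?HT = "insert (Eq Bool (?stop 1 0 ?n) (Con TrueC)) ?H"
      have "G | ?HT \<tturnstile> inst 0 (?Q 2 1 (Var 0)) ?n"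
        by (rule Hyp) (simp_all add: inst_def numeral_eq_Suc G_def has_type_iff)
      then have "G | ?HT \<tturnstile> Ex Nat (?Q 2 1 (Var 0))"
        by (rule ExI[rotated 2]) (simp_all add: G_def has_type_iff)
      then show "G | ?HT \<tturnstile> ?E 0" by simp
      \<comment> \<open>If the test failed at this \<open>k\<close>, then \<open>K k\<close> would
        be both a successor and 0.\<close>
      let ?H = "insert (Eq Bool (?stop 1 0 ?n) (Con FalseC)) ?H"
      let ?w = "(G, ?H)"
      have F: "cls ?w (?stop 1 0 ?n) = cls ?w (Con FalseC)"
        by (rule Eq_cls, rule Hyp) (simp_all add: G_def has_type_iff)
      have D: "cls ?w (minusC \<cdot> ?n \<cdot> ?n) = cls ?w (?K 2 1 0 ?n)"
        by (rule Eq_cls, rule Hyp) (simp_all add: G_def has_type_iff numeral_eq_Suc)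
      have "G | ?H \<tturnstile> BRF X (Prod R Nat) (Var 2)"
        using BR by (intro Hyp) (simp_all add: G_def)
      from kreisel_suc[OF this, of "cls ?w (Var 1)" "cls ?w (Var 0)" "cls ?w ?n"] F
      have "cls ?w (?K 2 1 0 ?n) = cls ?w (Con SucC \<cdot> ?K 2 1 0 (Con SucC \<cdot> ?n))"
        by (simp add: G_def)
      with D have "cls ?w (Con SucC \<cdot> ?K 2 1 0 (Con SucC \<cdot> ?n)) = cls ?w (Con ZeroC)"
        by (simp add: G_def minus_self)
      then have "G | ?H \<tturnstile> Eq Nat (Con SucC \<cdot> ?K 2 1 0 (Con SucC \<cdot> ?n)) (Con ZeroC)"
        by (rule EqI_cls) (simp add: G_def)
      from ImpE[OF prov_HA[OF suc_not_zero] this] have "G | ?H \<tturnstile> Bot"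
        by (simp add: has_type_iff G_def)
      then show "G | ?H \<tturnstile> ?E 0" by (rule BotE) (use wf in simp)
    qed
  qed
  then show ?thesis by simp
qed

text \<open>Generalised to a closed formula, hence provable in every world and applicable to shifted
  functionals.\<close>

lemma spector:
  "\<Gamma> | H \<tturnstile> All (BR_ty (X, Prod R Nat)) (BRF X (Prod R Nat) (Var 0) \<rightarrow>\<^sub>f
     All ((Nat \<rightarrowtail> X) \<rightarrowtail> Nat) (All (Nat \<rightarrowtail> X) (Ex Nat
       (Eq Bool (stopC X \<cdot> Var 2 \<cdot> Var 1 \<cdot> Var 0) (Con TrueC)))))"
  by (intro AllI ImpI spector_core) (simp_all add: lift_fm_def numeral_2_eq_2)

section \<open>Locality of bar recursion\<close>

text \<open>The functional \<omega> as seen from \<open>t\<close> onwards, to which Spector's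
  condition is applied.\<close>

definition compC :: "ty \<Rightarrow> tm" where
  "compC X = Lam ((Nat \<rightarrowtail> X) \<rightarrowtail> Nat) (Lam (Seq X) (Lam (Nat \<rightarrowtail> X) (Var 2 \<cdot> (catC X \<cdot> Var 1 \<cdot> Var 0))))"

lemma tyf_compC [simp]:
  "tyf e (compC X) = Some (((Nat \<rightarrowtail> X) \<rightarrowtail> Nat) \<rightarrowtail> Seq X \<rightarrowtail> (Nat \<rightarrowtail> X) \<rightarrowtail> Nat)"
  by (simp add: compC_def)

lemmas closed_compC [simp] = closed_simps[OF tyf_compC]

lemma comp_app:
  assumes "tyof w \<omega> = Some ((Nat \<rightarrowtail> X) \<rightarrowtail> Nat)" "tyof w t = Some (Seq X)" "tyof w a = Some (Nat \<rightarrowtail> X)"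
  shows "cls w (compC X) \<bullet>\<^bsub>w\<^esub> \<omega> \<bullet>\<^bsub>w\<^esub> t \<bullet>\<^bsub>w\<^esub> a = \<omega> \<bullet>\<^bsub>w\<^esub> (cls w (catC X) \<bullet>\<^bsub>w\<^esub> t \<bullet>\<^bsub>w\<^esub> a)"
  by (subst cls_ev[OF tyf_compC]) (use assms in \<open>simp add: compC_def\<close>)

lemma BR_stop:
  assumes "\<Gamma> | H \<tturnstile> BRF X R B" "tyf (env \<Gamma>) B = Some (BR_ty (X, R))"
    and "tyof (\<Gamma>, H) \<omega> = Some ((Nat \<rightarrowtail> X) \<rightarrowtail> Nat)" "tyof (\<Gamma>, H) s = Some (Seq X)"
    and "tyof (\<Gamma>, H) \<phi> = Some (Seq X \<rightarrowtail> K_ty R X)" "tyof (\<Gamma>, H) q = Some ((Nat \<rightarrowtail> X) \<rightarrowtail> R)"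
  defines "w \<equiv> (\<Gamma>, H)"
  assumes "cls w lessC \<bullet>\<^bsub>w\<^esub> (\<omega> \<bullet>\<^bsub>w\<^esub> (cls w (catC X) \<bullet>\<^bsub>w\<^esub> s \<bullet>\<^bsub>w\<^esub> cls w (zero (Nat \<rightarrowtail> X))))
      \<bullet>\<^bsub>w\<^esub> (cls w (lenC X) \<bullet>\<^bsub>w\<^esub> s) = cls w (Con TrueC)"
  shows "cls w B \<bullet>\<^bsub>w\<^esub> \<omega> \<bullet>\<^bsub>w\<^esub> s \<bullet>\<^bsub>w\<^esub> \<phi> \<bullet>\<^bsub>w\<^esub> q = q \<bullet>\<^bsub>w\<^esub> (cls w (catC X) \<bullet>\<^bsub>w\<^esub> s \<bullet>\<^bsub>w\<^esub> cls w (zero (Nat \<rightarrowtail> X)))"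
  using BR_rule[OF assms(1-6), folded w_def] assms(2-6,8) unfolding w_def by simp

text \<open>In \<open>G\<close>, the indices \<open>0, \<dots>, 6\<close> stand for \<open>t\<close>, \<open>q'\<close>, \<open>q\<close>, \<open>\<phi>\<close>, \<open>\<omega>'\<close>, \<open>\<omega>\<close>, \<open>B\<close>.\<close>

lemma locality_core:
  fixes X R \<Gamma>
  defines "G \<equiv> Seq X # ((Nat \<rightarrowtail> X) \<rightarrowtail> Prod R Nat) # ((Nat \<rightarrowtail> X) \<rightarrowtail> Prod R Nat)
    # (Seq X \<rightarrowtail> K_ty (Prod R Nat) X) # ((Nat \<rightarrowtail> X) \<rightarrowtail> Nat) # ((Nat \<rightarrowtail> X) \<rightarrowtail> Nat) # BR_ty (X, Prod R Nat) # \<Gamma>"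
    and "agree \<equiv> \<lambda>T f g. All (Nat \<rightarrowtail> X) (Eq T (Var f \<cdot> (catC X \<cdot> Var 1 \<cdot> Var 0))
      (Var g \<cdot> (catC X \<cdot> Var 1 \<cdot> Var 0)))"
  assumes H: "BRF X (Prod R Nat) (Var 6) \<in> H" "agree Nat 6 5 \<in> H" "agree (Prod R Nat) 3 2 \<in> H"
  shows "G | H \<tturnstile> Eq (Prod R Nat) (Var 6 \<cdot> Var 5 \<cdot> Var 0 \<cdot> Var 3 \<cdot> Var 2)
    (Var 6 \<cdot> Var 4 \<cdot> Var 0 \<cdot> Var 3 \<cdot> Var 1)"
proof -
  \<comment> \<open>The relativising predicate admits every sequence.\<close>
  let ?S = "Eq Bool (Con TrueC) (Con TrueC)"
  \<comment> \<open>\<open>k\<close> counts the binders on top of \<open>G\<close>. The induction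
    variable is the extension \<open>u\<close> of \<open>t\<close>, as the agreement hypotheses say
    nothing about other sequences.\<close>
  let ?L = "\<lambda>k u. Var (6 + k) \<cdot> Var (5 + k) \<cdot> (fcatC X \<cdot> Var k \<cdot> u) \<cdot> Var (3 + k) \<cdot> Var (2 + k)"
  let ?R = "\<lambda>k u. Var (6 + k) \<cdot> Var (4 + k) \<cdot> (fcatC X \<cdot> Var k \<cdot> u) \<cdot> Var (3 + k) \<cdot> Var (1 + k)"
  let ?P = "\<lambda>k u. Eq (Prod R Nat) (?L k u) (?R k u)"
  have wf: "wf_fm (Seq X # G) ?S" "wf_fm (Seq X # G) (?P 1 (Var 0))"
    by (simp_all add: G_def has_type_iff)
  note sim = inst_def numeral_eq_Suc
  have "G | H \<tturnstile> inst 0 (?P 1 (Var 0)) (Con (NilC X))"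
  proof (rule ImpE[OF ImpE[OF ImpE[OF Ax]]])
    show "(G, inst 0 ?S (Con (NilC X))
        \<rightarrow>\<^sub>f All (Nat \<rightarrowtail> X)
             (All Nat (inst 2 ?S (initC X \<cdot> Var 1 \<cdot> Var 0))
                \<rightarrow>\<^sub>f Ex Nat (inst 2 (?P 1 (Var 0)) (initC X \<cdot> Var 1 \<cdot> Var 0)))
        \<rightarrow>\<^sub>f All (Seq X)
             (?S \<rightarrow>\<^sub>f All X (inst 2 ?S (snoc X (Var 1) (Var 0)) \<rightarrow>\<^sub>f
                 inst 2 (?P 1 (Var 0)) (snoc X (Var 1) (Var 0)))
                \<rightarrow>\<^sub>f ?P 1 (Var 0))
        \<rightarrow>\<^sub>f inst 0 (?P 1 (Var 0)) (Con (NilC X))) \<in> HA_omega \<union> BI"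
      by (rule UnI2, rule bar_induct[OF wf])
    show "G | H \<tturnstile> inst 0 ?S (Con (NilC X))"
      by (simp add: inst_def) (rule EqI, simp add: has_type_iff)
    let ?\<alpha> = "initC X \<cdot> Var 1 \<cdot> Var 0"
    have "G | H \<tturnstile> All (Nat \<rightarrowtail> X) (All Nat ?S \<rightarrow>\<^sub>f Ex Nat (?P 2 ?\<alpha>))"
    proof (rule AllI, rule ImpI)
      let ?G = "(Nat \<rightarrowtail> X) # G" and ?H = "insert (All Nat ?S) (lift_fm ` H)"
      have "lift_fm (BRF X (Prod R Nat) (Var 6)) \<in> ?H" using H(1) by blast
      then have BR: "?G | ?H \<tturnstile> BRF X (Prod R Nat) (Var 7)"
        by (intro Hyp) (simp_all add: lift_fm_def G_def)
      have "?G | ?H \<tturnstile> sub_fm (case_nat (Var 7) Var) (BRF X (Prod R Nat) (Var 0) \<rightarrow>\<^sub>f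
        All ((Nat \<rightarrowtail> X) \<rightarrowtail> Nat) (All (Nat \<rightarrowtail> X) (Ex Nat
          (Eq Bool (stopC X \<cdot> Var 2 \<cdot> Var 1 \<cdot> Var 0) (Con TrueC)))))"
        by (rule AllE_sub, subst sub_fm_Var, rule spector) (simp add: G_def has_type_iff)
      then have "?G | ?H \<tturnstile> sub_fm (case_nat (Var 7) Var)
        (All ((Nat \<rightarrowtail> X) \<rightarrowtail> Nat) (All (Nat \<rightarrowtail> X) (Ex Nat
          (Eq Bool (stopC X \<cdot> Var 2 \<cdot> Var 1 \<cdot> Var 0) (Con TrueC)))))"
        using BR ImpE by simp
      \<comment> \<open>Spector's condition for \<omega> shifted by \<open>t\<close>: some
        \<open>n\<close> satisfies \<open>\<omega> (t * [\<alpha>](n) * 0) < n\<close>.\<close>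
      from AllE_sub[OF AllE_sub[OF this, of "compC X \<cdot> Var 6 \<cdot> Var 1"], of "Var 0"]
      have "?G | ?H \<tturnstile> Ex Nat (Eq Bool (stopC X \<cdot> (compC X \<cdot> Var 7 \<cdot> Var 2) \<cdot> Var 1 \<cdot> Var 0)
          (Con TrueC))"
        by (simp add: has_type_iff G_def numeral_eq_Suc)
      then show "?G | ?H \<tturnstile> Ex Nat (?P 2 ?\<alpha>)"
      proof (rule ExE)
        show "wf_fm ?G (Ex Nat (?P 2 ?\<alpha>))" by (simp add: G_def has_type_iff)
        let ?G = "Nat # ?G"
          and ?H = "insert (Eq Bool (stopC X \<cdot> (compC X \<cdot> Var 7 \<cdot> Var 2) \<cdot> Var 1 \<cdot> Var 0)
              (Con TrueC)) (lift_fm ` ?H)"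
        let ?w = "(?G, ?H)"
        have "cls ?w (stopC X \<cdot> (compC X \<cdot> Var 7 \<cdot> Var 2) \<cdot> Var 1 \<cdot> Var 0) = cls ?w (Con TrueC)"
          by (rule Eq_cls, rule Hyp) (simp_all add: G_def has_type_iff)
        \<comment> \<open>The bound \<open>n\<close> is replaced by the full length of
          \<open>t * [\<alpha>](n)\<close>, which is what \<open>BR\<close> tests.\<close>
        then have less: "cls ?w (lessC \<cdot> (Var 7 \<cdot> (catC X \<cdot> Var 2 \<cdot> (catC X \<cdot> ?\<alpha> \<cdot> zero (Nat \<rightarrowtail> X))))
              \<cdot> (lenC X \<cdot> (fcatC X \<cdot> Var 2 \<cdot> ?\<alpha>)))
             = cls ?w (Con TrueC)"
          by (simp add: G_def stop_app comp_app less_len_fcat)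
        have "lift_fm (lift_fm (BRF X (Prod R Nat) (Var 6))) \<in> ?H" using H(1) by blast
        then have BR: "?G | ?H \<tturnstile> BRF X (Prod R Nat) (Var 8)"
          by (intro Hyp) (simp_all add: lift_fm_def G_def)
        have "lift_fm (lift_fm (agree Nat 6 5)) \<in> ?H" using H(2) by blast
        then have "?G | ?H \<tturnstile> All (Nat \<rightarrowtail> X) (Eq Nat (Var 8 \<cdot> (catC X \<cdot> Var 3 \<cdot> Var 0))
            (Var 7 \<cdot> (catC X \<cdot> Var 3 \<cdot> Var 0)))"
          by (intro Hyp) (simp_all add: lift_fm_def G_def agree_def has_type_iff numeral_eq_Suc)
        from All_Eq_cls[OF this, of "cls ?w (catC X \<cdot> ?\<alpha> \<cdot> zero (Nat \<rightarrowtail> X))"]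
        have \<omega>: "cls ?w (Var 7 \<cdot> (catC X \<cdot> Var 2 \<cdot> (catC X \<cdot> ?\<alpha> \<cdot> zero (Nat \<rightarrowtail> X))))
           = cls ?w (Var 6 \<cdot> (catC X \<cdot> Var 2 \<cdot> (catC X \<cdot> ?\<alpha> \<cdot> zero (Nat \<rightarrowtail> X))))"
          by (simp add: G_def)
        have "lift_fm (lift_fm (agree (Prod R Nat) 3 2)) \<in> ?H" using H(3) by blast
        then have "?G | ?H \<tturnstile> All (Nat \<rightarrowtail> X) (Eq (Prod R Nat) (Var 5 \<cdot> (catC X \<cdot> Var 3 \<cdot> Var 0))
            (Var 4 \<cdot> (catC X \<cdot> Var 3 \<cdot> Var 0)))"
          by (intro Hyp) (simp_all add: lift_fm_def G_def agree_def has_type_iff numeral_eq_Suc)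
        from All_Eq_cls[OF this, of "cls ?w (catC X \<cdot> ?\<alpha> \<cdot> zero (Nat \<rightarrowtail> X))"]
        have q: "cls ?w (Var 4 \<cdot> (catC X \<cdot> Var 2 \<cdot> (catC X \<cdot> ?\<alpha> \<cdot> zero (Nat \<rightarrowtail> X))))
           = cls ?w (Var 3 \<cdot> (catC X \<cdot> Var 2 \<cdot> (catC X \<cdot> ?\<alpha> \<cdot> zero (Nat \<rightarrowtail> X))))"
          by (simp add: G_def)
        let ?s = "cls ?w (fcatC X \<cdot> Var 2 \<cdot> ?\<alpha>)"
        let ?c = "catC X \<cdot> Var 2 \<cdot> (catC X \<cdot> ?\<alpha> \<cdot> zero (Nat \<rightarrowtail> X))"
        have "cls ?w (?L 2 ?\<alpha>) = cls ?w (Var 4 \<cdot> ?c)"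
          using BR_stop[OF BR, of "cls ?w (Var 7)" ?s "cls ?w (Var 5)" "cls ?w (Var 4)"] less
          by (simp add: G_def cat_fcat)
        \<comment> \<open>The second recursion stops at the same point, since its control functional
          takes the same value there.\<close>
        moreover have "cls ?w (lessC \<cdot> (Var 6 \<cdot> ?c) \<cdot> (lenC X \<cdot> (fcatC X \<cdot> Var 2 \<cdot> ?\<alpha>)))
            = cls ?w (Con TrueC)"
          using less by (simp only: cls_App[of _ lessC] cls_App[of _ "lessC \<cdot> _"] \<omega>)
        then have "cls ?w (?R 2 ?\<alpha>) = cls ?w (Var 3 \<cdot> ?c)"
          using BR_stop[OF BR, of "cls ?w (Var 6)" ?s "cls ?w (Var 5)" "cls ?w (Var 3)"]
          by (simp add: G_def cat_fcat numeral_eq_Suc)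
        ultimately have "cls ?w (?L 2 ?\<alpha>) = cls ?w (?R 2 ?\<alpha>)" using q by simp
        then have "?G | ?H \<tturnstile> ?P 2 ?\<alpha>" by (rule EqI_cls) (simp add: G_def)
        then have "?G | ?H \<tturnstile> inst 0 (?P 3 (initC X \<cdot> Var 2 \<cdot> Var 0)) (Var 0)"
          by (simp add: sim)
        then have "?G | ?H \<tturnstile> Ex Nat (?P 3 (initC X \<cdot> Var 2 \<cdot> Var 0))"
          by (rule ExI[rotated 2]) (simp_all add: G_def has_type_iff)
        then show "?G | ?H \<tturnstile> lift_fm (Ex Nat (?P 2 ?\<alpha>))"
          by (simp add: lift_fm_def numeral_eq_Suc)
      qed
    qed (simp add: has_type_iff)
    then show "G | H \<tturnstile> All (Nat \<rightarrowtail> X)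
             (All Nat (inst 2 ?S (initC X \<cdot> Var 1 \<cdot> Var 0))
                \<rightarrow>\<^sub>f Ex Nat (inst 2 (?P 1 (Var 0)) (initC X \<cdot> Var 1 \<cdot> Var 0)))"
      by (simp add: sim)
    have "G | H \<tturnstile> All (Seq X) (?S \<rightarrow>\<^sub>f All X (?S \<rightarrow>\<^sub>f ?P 2 (snoc X (Var 1) (Var 0))) \<rightarrow>\<^sub>f ?P 1 (Var 0))"
    proof (rule AllI, rule ImpI[OF wf(1)], rule ImpI)
      let ?G = "Seq X # G"
        and ?H = "insert (All X (?S \<rightarrow>\<^sub>f ?P 2 (snoc X (Var 1) (Var 0)))) (insert ?S (lift_fm ` H))"
      let ?w = "(?G, ?H)"
      have "lift_fm (BRF X (Prod R Nat) (Var 6)) \<in> ?H" using H(1) by blast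
      then have BR: "?G | ?H \<tturnstile> BRF X (Prod R Nat) (Var 7)"
        by (intro Hyp) (simp_all add: lift_fm_def G_def)
      let ?Z = "catC X \<cdot> Var 0 \<cdot> zero (Nat \<rightarrowtail> X)"
      have "lift_fm (agree Nat 6 5) \<in> ?H" using H(2) by blast
      then have "?G | ?H \<tturnstile> All (Nat \<rightarrowtail> X) (Eq Nat (Var 7 \<cdot> (catC X \<cdot> Var 2 \<cdot> Var 0)) (Var 6
          \<cdot> (catC X \<cdot> Var 2 \<cdot> Var 0)))"
        by (intro Hyp) (simp_all add: lift_fm_def G_def agree_def has_type_iff numeral_eq_Suc)
      from All_Eq_cls[OF this, of "cls ?w ?Z"]
      have \<omega>: "cls ?w (Var 6 \<cdot> (catC X \<cdot> Var 1 \<cdot> ?Z)) = cls ?w (Var 5 \<cdot> (catC X \<cdot> Var 1 \<cdot> ?Z))"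
        by (simp add: G_def)
      have "lift_fm (agree (Prod R Nat) 3 2) \<in> ?H" using H(3) by blast
      then have "?G | ?H \<tturnstile> All (Nat \<rightarrowtail> X) (Eq (Prod R Nat) (Var 4 \<cdot> (catC X \<cdot> Var 2
          \<cdot> Var 0)) (Var 3 \<cdot> (catC X \<cdot> Var 2 \<cdot> Var 0)))"
        by (intro Hyp) (simp_all add: lift_fm_def G_def agree_def has_type_iff numeral_eq_Suc)
      from All_Eq_cls[OF this, of "cls ?w ?Z"]
      have q: "cls ?w (Var 3 \<cdot> (catC X \<cdot> Var 1 \<cdot> ?Z)) = cls ?w (Var 2 \<cdot> (catC X \<cdot> Var 1 \<cdot> ?Z))"
        by (simp add: G_def)
      let ?s = "fcatC X \<cdot> Var 1 \<cdot> Var 0"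
      let ?N1 = "nextC X (Prod R Nat) \<cdot> Var 7 \<cdot> Var 6 \<cdot> ?s \<cdot> Var 4 \<cdot> Var 3"
      let ?N2 = "nextC X (Prod R Nat) \<cdot> Var 7 \<cdot> Var 5 \<cdot> ?s \<cdot> Var 4 \<cdot> Var 2"
      \<comment> \<open>\<phi> receives the recursive calls as a function, so the equations at all
        one-step extensions are combined into an equation of functions by extensionality.\<close>
      have N: "cls ?w ?N1 = cls ?w ?N2"
      proof (rule xi_cls[where T=X and U="Prod R Nat"])
        let ?G' = "X # ?G" and ?H' = "lift_fm ` ?H"
        have "?G' | ?H' \<tturnstile> All X (?S \<rightarrow>\<^sub>f ?P 3 (snoc X (Var 2) (Var 0)))"
          by (rule Hyp) (simp_all add: lift_fm_def G_def has_type_iff numeral_eq_Suc)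
        from All_Imp_Eq_cls[OF this, of "cls (?G', ?H') (Var 0)"]
        have "cls (?G', ?H') (?L 2 (snoc X (Var 1) (Var 0)))
            = cls (?G', ?H') (?R 2 (snoc X (Var 1) (Var 0)))"
          by (simp add: G_def numeral_eq_Suc)
        then show "cls (?G', ?H') (lift 1 ?N1 \<cdot> Var 0) = cls (?G', ?H') (lift 1 ?N2 \<cdot> Var 0)"
          by (simp add: G_def numeral_eq_Suc)
      qed (simp_all add: G_def has_type_iff)
      \<comment> \<open>Both sides unfold to conditionals with equal tests, equal leaf values and
        equal arguments of \<phi>, so congruence suffices and the test need not be decided.\<close>
      have "cls ?w (?L 1 (Var 0)) = cls ?w (?R 1 (Var 0))"
        using BR_rule[OF BR, of "cls ?w (Var 6)" "cls ?w ?s" "cls ?w (Var 4)" "cls ?w (Var 3)"]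
          BR_rule[OF BR, of "cls ?w (Var 5)" "cls ?w ?s" "cls ?w (Var 4)" "cls ?w (Var 2)"] \<omega> q N
        by (simp add: G_def cat_fcat numeral_eq_Suc)
      then show "?G | ?H \<tturnstile> ?P 1 (Var 0)" by (rule EqI_cls) (simp add: G_def)
    qed (simp add: G_def has_type_iff)
    then show "G | H \<tturnstile> All (Seq X)
             (?S \<rightarrow>\<^sub>f All X (inst 2 ?S (snoc X (Var 1) (Var 0)) \<rightarrow>\<^sub>f
                 inst 2 (?P 1 (Var 0)) (snoc X (Var 1) (Var 0)))
                \<rightarrow>\<^sub>f ?P 1 (Var 0))"
      by (simp add: sim)
  qed
  then have "G | H \<tturnstile> ?P 0 (Con (NilC X))" by (simp add: sim)
  then have "cls (G, H) (?L 0 (Con (NilC X))) = cls (G, H) (?R 0 (Con (NilC X)))"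
    by (rule Eq_cls) (simp_all add: G_def)
  then show ?thesis by (intro EqI_cls) (simp_all add: G_def)
qed

lemma locality:
  "\<Gamma> | H \<tturnstile> All (BR_ty (X, Prod R Nat)) (BRF X (Prod R Nat) (Var 0) \<rightarrow>\<^sub>f
     All ((Nat \<rightarrowtail> X) \<rightarrowtail> Nat) (All ((Nat \<rightarrowtail> X) \<rightarrowtail> Nat) (All (Seq X \<rightarrowtail> K_ty (Prod R Nat) X)
     (All ((Nat \<rightarrowtail> X) \<rightarrowtail> Prod R Nat) (All ((Nat \<rightarrowtail> X) \<rightarrowtail> Prod R Nat) (All (Seq X)
       (All (Nat \<rightarrowtail> X) (Eq Nat (Var 6 \<cdot> (catC X \<cdot> Var 1 \<cdot> Var 0))
         (Var 5 \<cdot> (catC X \<cdot> Var 1 \<cdot> Var 0))) \<rightarrow>\<^sub>f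
        All (Nat \<rightarrowtail> X) (Eq (Prod R Nat) (Var 3 \<cdot> (catC X \<cdot> Var 1 \<cdot> Var 0))
         (Var 2 \<cdot> (catC X \<cdot> Var 1 \<cdot> Var 0))) \<rightarrow>\<^sub>f
        Eq (Prod R Nat) (Var 6 \<cdot> Var 5 \<cdot> Var 0 \<cdot> Var 3 \<cdot> Var 2)
         (Var 6 \<cdot> Var 4 \<cdot> Var 0 \<cdot> Var 3 \<cdot> Var 1))))))))"
  by (intro AllI ImpI locality_core) (simp_all add: lift_fm_def numeral_eq_Suc has_type_iff)

section \<open>The product of quantifiers\<close>

definition omegaC :: "ty \<Rightarrow> ty \<Rightarrow> tm" where
  "omegaC X R = Lam (R \<rightarrowtail> Nat) (Lam (Seq X) (Lam ((Nat \<rightarrowtail> X) \<rightarrowtail> R) (Lam (Nat \<rightarrowtail> X)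
     (Var 3 \<cdot> (Var 1 \<cdot> (dropC X \<cdot> Var 2 \<cdot> Var 0))))))"

definition leafC :: "ty \<Rightarrow> ty \<Rightarrow> tm" where
  "leafC X R = Lam (Seq X) (Lam ((Nat \<rightarrowtail> X) \<rightarrowtail> R) (Lam (Nat \<rightarrowtail> X)
     (Con (PairC R Nat) \<cdot> (Var 1 \<cdot> (dropC X \<cdot> Var 2 \<cdot> Var 0)) \<cdot> Con ZeroC)))"

definition fst_compC :: "ty \<Rightarrow> ty \<Rightarrow> tm" where
  "fst_compC X R = Lam (X \<rightarrowtail> Prod R Nat) (Lam X (Con (FstC R Nat) \<cdot> (Var 1 \<cdot> Var 0)))"

text \<open>Lifts \<phi> to pairs: it sees only the first components of the recursive calls and
  returns its value padded with 0.\<close>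

definition phiC :: "ty \<Rightarrow> ty \<Rightarrow> tm" where
  "phiC X R = Lam (Seq X \<rightarrowtail> K_ty R X) (Lam (Seq X) (Lam (X \<rightarrowtail> Prod R Nat)
     (Con (PairC R Nat) \<cdot> (Var 2 \<cdot> Var 1 \<cdot> (fst_compC X R \<cdot> Var 0)) \<cdot> Con ZeroC)))"

text \<open>A closed form of the section \<open>q\<^sub>x\<close>, with
  \<open>cons x \<alpha>\<close> for the concatenation of the one-element sequence with
  \<alpha>.\<close>

definition sectC :: "ty \<Rightarrow> ty \<Rightarrow> tm" where
  "sectC X R = Lam ((Nat \<rightarrowtail> X) \<rightarrowtail> R) (Lam X (Lam (Nat \<rightarrowtail> X) (Var 2 \<cdot> (consC X \<cdot> Var 1 \<cdot> Var 0))))"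

lemma tyf_omegaC [simp]:
  "tyf e (omegaC X R) = Some ((R \<rightarrowtail> Nat) \<rightarrowtail> Seq X \<rightarrowtail> ((Nat \<rightarrowtail> X) \<rightarrowtail> R) \<rightarrowtail> (Nat \<rightarrowtail> X) \<rightarrowtail> Nat)"
  by (simp add: omegaC_def)

lemma tyf_leafC [simp]:
  "tyf e (leafC X R) = Some (Seq X \<rightarrowtail> ((Nat \<rightarrowtail> X) \<rightarrowtail> R) \<rightarrowtail> (Nat \<rightarrowtail> X) \<rightarrowtail> Prod R Nat)"
  by (simp add: leafC_def)

lemma tyf_fst_compC [simp]: "tyf e (fst_compC X R) = Some ((X \<rightarrowtail> Prod R Nat) \<rightarrowtail> X \<rightarrowtail> R)"
  by (simp add: fst_compC_def)

lemma tyf_sectC [simp]: "tyf e (sectC X R) = Some (((Nat \<rightarrowtail> X) \<rightarrowtail> R) \<rightarrowtail> X \<rightarrowtail> (Nat \<rightarrowtail> X) \<rightarrowtail> R)"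
  by (simp add: sectC_def)

lemma tyf_phiC [simp]: "tyf e (phiC X R) = Some ((Seq X \<rightarrowtail> K_ty R X) \<rightarrowtail> Seq X \<rightarrowtail> K_ty (Prod R Nat) X)"
  by (simp add: phiC_def)

lemmas closed_EPQ_consts [simp] = closed_simps[OF tyf_omegaC] closed_simps[OF tyf_leafC]
  closed_simps[OF tyf_fst_compC] closed_simps[OF tyf_phiC] closed_simps[OF tyf_sectC]

definition epqC :: "ty \<Rightarrow> ty \<Rightarrow> tm" where
  "epqC X R = Lam (BR_ty (X, Prod R Nat)) (Lam (R \<rightarrowtail> Nat) (Lam (Seq X) (Lam (Seq X \<rightarrowtail> K_ty R X)
     (Lam ((Nat \<rightarrowtail> X) \<rightarrowtail> R) (Con (FstC R Nat) \<cdot> (Var 4 \<cdot> (omegaC X R \<cdot> Var 3 \<cdot> Var 2 \<cdot> Var 0)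
        \<cdot> Var 2 \<cdot> (phiC X R \<cdot> Var 1) \<cdot> (leafC X R \<cdot> Var 2 \<cdot> Var 0)))))))"

lemma tyf_epqC [simp]: "tyf e (epqC X R) = Some (BR_ty (X, Prod R Nat) \<rightarrowtail> EPQ_ty (X, R))"
  by (simp add: epqC_def EPQ_ty_def)

lemmas closed_epqC [simp] = closed_simps[OF tyf_epqC]

declare EPQ_ty_def [simp]

lemma omega_app:
  assumes "tyof w l = Some (R \<rightarrowtail> Nat)" "tyof w s = Some (Seq X)" "tyof w q = Some ((Nat \<rightarrowtail> X) \<rightarrowtail> R)"
    "tyof w a = Some (Nat \<rightarrowtail> X)"
  shows "cls w (omegaC X R) \<bullet>\<^bsub>w\<^esub> l \<bullet>\<^bsub>w\<^esub> s \<bullet>\<^bsub>w\<^esub> q \<bullet>\<^bsub>w\<^esub> a = l \<bullet>\<^bsub>w\<^esub> (q \<bullet>\<^bsub>w\<^esub> (cls w (dropC X) \<bullet>\<^bsub>w\<^esub> s \<bullet>\<^bsub>w\<^esub> a))"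
  by (subst cls_ev[OF tyf_omegaC]) (use assms in \<open>simp add: omegaC_def\<close>)

lemma leaf_app:
  assumes "tyof w s = Some (Seq X)" "tyof w q = Some ((Nat \<rightarrowtail> X) \<rightarrowtail> R)" "tyof w a = Some (Nat \<rightarrowtail> X)"
  shows "cls w (leafC X R) \<bullet>\<^bsub>w\<^esub> s \<bullet>\<^bsub>w\<^esub> q \<bullet>\<^bsub>w\<^esub> a
      = cls w (Con (PairC R Nat)) \<bullet>\<^bsub>w\<^esub> (q \<bullet>\<^bsub>w\<^esub> (cls w (dropC X) \<bullet>\<^bsub>w\<^esub> s \<bullet>\<^bsub>w\<^esub> a)) \<bullet>\<^bsub>w\<^esub> cls w (Con ZeroC)"
  by (subst cls_ev[OF tyf_leafC]) (use assms in \<open>simp add: leafC_def\<close>)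

lemma fst_comp_app:
  assumes "tyof w p = Some (X \<rightarrowtail> Prod R Nat)" "tyof w x = Some X"
  shows "cls w (fst_compC X R) \<bullet>\<^bsub>w\<^esub> p \<bullet>\<^bsub>w\<^esub> x = cls w (Con (FstC R Nat)) \<bullet>\<^bsub>w\<^esub> (p \<bullet>\<^bsub>w\<^esub> x)"
  by (subst cls_ev[OF tyf_fst_compC]) (use assms in \<open>simp add: fst_compC_def\<close>)

lemma phi_app:
  assumes "tyof w f = Some (Seq X \<rightarrowtail> K_ty R X)" "tyof w s = Some (Seq X)"
    "tyof w p = Some (X \<rightarrowtail> Prod R Nat)"
  shows "cls w (phiC X R) \<bullet>\<^bsub>w\<^esub> f \<bullet>\<^bsub>w\<^esub> s \<bullet>\<^bsub>w\<^esub> p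
    = cls w (Con (PairC R Nat)) \<bullet>\<^bsub>w\<^esub> (f \<bullet>\<^bsub>w\<^esub> s \<bullet>\<^bsub>w\<^esub> (cls w (fst_compC X R) \<bullet>\<^bsub>w\<^esub> p)) \<bullet>\<^bsub>w\<^esub> cls w (Con ZeroC)"
  by (subst cls_ev[OF tyf_phiC]) (use assms in \<open>simp add: phiC_def\<close>)

lemma sect_app:
  assumes "tyof w q = Some ((Nat \<rightarrowtail> X) \<rightarrowtail> R)" "tyof w x = Some X" "tyof w a = Some (Nat \<rightarrowtail> X)"
  shows "cls w (sectC X R) \<bullet>\<^bsub>w\<^esub> q \<bullet>\<^bsub>w\<^esub> x \<bullet>\<^bsub>w\<^esub> a = q \<bullet>\<^bsub>w\<^esub> (cls w (consC X) \<bullet>\<^bsub>w\<^esub> x \<bullet>\<^bsub>w\<^esub> a)"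
  by (subst cls_ev[OF tyf_sectC]) (use assms in \<open>simp add: sectC_def\<close>)

lemma epq_app:
  assumes "tyof w b = Some (BR_ty (X, Prod R Nat))" "tyof w l = Some (R \<rightarrowtail> Nat)"
    "tyof w s = Some (Seq X)" "tyof w f = Some (Seq X \<rightarrowtail> K_ty R X)" "tyof w q = Some ((Nat \<rightarrowtail> X) \<rightarrowtail> R)"
  shows "cls w (epqC X R) \<bullet>\<^bsub>w\<^esub> b \<bullet>\<^bsub>w\<^esub> l \<bullet>\<^bsub>w\<^esub> s \<bullet>\<^bsub>w\<^esub> f \<bullet>\<^bsub>w\<^esub> q = cls w (Con (FstC R Nat)) \<bullet>\<^bsub>w\<^esub>
    (b \<bullet>\<^bsub>w\<^esub> (cls w (omegaC X R) \<bullet>\<^bsub>w\<^esub> l \<bullet>\<^bsub>w\<^esub> s \<bullet>\<^bsub>w\<^esub> q) \<bullet>\<^bsub>w\<^esub> s \<bullet>\<^bsub>w\<^esub> (cls w (phiC X R) \<bullet>\<^bsub>w\<^esub> f)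
        \<bullet>\<^bsub>w\<^esub> (cls w (leafC X R) \<bullet>\<^bsub>w\<^esub> s \<bullet>\<^bsub>w\<^esub> q))"
  by (subst cls_ev[OF tyf_epqC]) (use assms in \<open>simp add: epqC_def\<close>)

text \<open>\<open>locality\<close> at arbitrary terms; agreement on the extensions of
  \<open>s\<close> is checked at a generic \<alpha>, a fresh variable.\<close>

lemma locality_cls:
  fixes X R \<Gamma> H
  defines "w \<equiv> ((Nat \<rightarrowtail> X) # \<Gamma>, lift_fm ` H)"
  assumes BR: "\<Gamma> | H \<tturnstile> BRF X (Prod R Nat) B" "tyf (env \<Gamma>) B = Some (BR_ty (X, Prod R Nat))"
    and ty: "tyf (env \<Gamma>) \<omega> = Some ((Nat \<rightarrowtail> X) \<rightarrowtail> Nat)" "tyf (env \<Gamma>) \<omega>' = Some ((Nat \<rightarrowtail> X) \<rightarrowtail> Nat)"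
      "tyf (env \<Gamma>) \<phi> = Some (Seq X \<rightarrowtail> K_ty (Prod R Nat) X)"
      "tyf (env \<Gamma>) q = Some ((Nat \<rightarrowtail> X) \<rightarrowtail> Prod R Nat)"
      "tyf (env \<Gamma>) q' = Some ((Nat \<rightarrowtail> X) \<rightarrowtail> Prod R Nat)" "tyf (env \<Gamma>) s = Some (Seq X)"
    and \<omega>: "cls w (lift 1 \<omega> \<cdot> (catC X \<cdot> lift 1 s \<cdot> Var 0))
        = cls w (lift 1 \<omega>' \<cdot> (catC X \<cdot> lift 1 s \<cdot> Var 0))"
    and q: "cls w (lift 1 q \<cdot> (catC X \<cdot> lift 1 s \<cdot> Var 0))
        = cls w (lift 1 q' \<cdot> (catC X \<cdot> lift 1 s \<cdot> Var 0))"
  shows "cls (\<Gamma>, H) (B \<cdot> \<omega> \<cdot> s \<cdot> \<phi> \<cdot> q) = cls (\<Gamma>, H) (B \<cdot> \<omega>' \<cdot> s \<cdot> \<phi> \<cdot> q')"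
proof -
  note ty' = ty[folded has_type_iff]
  let ?agree = "\<lambda>T f g. All (Nat \<rightarrowtail> X) (Eq T (lift (Suc 0) f \<cdot> (catC X \<cdot> lift (Suc 0) s \<cdot> Var 0))
    (lift (Suc 0) g \<cdot> (catC X \<cdot> lift (Suc 0) s \<cdot> Var 0)))"
  have 1: "\<Gamma> | H \<tturnstile> ?agree Nat \<omega> \<omega>'"
    by (rule AllI, rule EqI_cls) (use \<omega> ty in \<open>simp_all add: w_def tyf_lift\<close>)
  have 2: "\<Gamma> | H \<tturnstile> ?agree (Prod R Nat) q q'"
    by (rule AllI, rule EqI_cls) (use q ty in \<open>simp_all add: w_def tyf_lift\<close>)
  have "\<Gamma> \<turnstile> B \<Ztypecolon> BR_ty (X, Prod R Nat)" using BR(2) by (simp add: has_type_iff)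
  from AllE_sub[where \<sigma>=Var, unfolded sub_fm_Var, OF locality this]
  have "\<Gamma> | H \<tturnstile> (BRF X (Prod R Nat) B \<rightarrow>\<^sub>f sub_fm (case_nat B Var) (All ((Nat \<rightarrowtail> X) \<rightarrowtail> Nat)
     (All ((Nat \<rightarrowtail> X) \<rightarrowtail> Nat) (All (Seq X \<rightarrowtail> K_ty (Prod R Nat) X)
     (All ((Nat \<rightarrowtail> X) \<rightarrowtail> Prod R Nat) (All ((Nat \<rightarrowtail> X) \<rightarrowtail> Prod R Nat) (All (Seq X)
       (All (Nat \<rightarrowtail> X) (Eq Nat (Var 6 \<cdot> (catC X \<cdot> Var 1 \<cdot> Var 0))
         (Var 5 \<cdot> (catC X \<cdot> Var 1 \<cdot> Var 0))) \<rightarrow>\<^sub>f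
        All (Nat \<rightarrowtail> X) (Eq (Prod R Nat) (Var 3 \<cdot> (catC X \<cdot> Var 1 \<cdot> Var 0))
         (Var 2 \<cdot> (catC X \<cdot> Var 1 \<cdot> Var 0))) \<rightarrow>\<^sub>f
        Eq (Prod R Nat) (Var 6 \<cdot> Var 5 \<cdot> Var 0 \<cdot> Var 3 \<cdot> Var 2)
         (Var 6 \<cdot> Var 4 \<cdot> Var 0 \<cdot> Var 3 \<cdot> Var 1)))))))))"
    by simp
  note ImpE[OF this BR(1)]
  from AllE_sub[OF AllE_sub[OF AllE_sub[OF AllE_sub[OF AllE_sub[OF AllE_sub[OF this ty'(1)]
      ty'(2)] ty'(3)] ty'(4)] ty'(5)] ty'(6)]
  have "\<Gamma> | H \<tturnstile> (?agree Nat \<omega> \<omega>' \<rightarrow>\<^sub>f ?agree (Prod R Nat) q q' \<rightarrow>\<^sub>f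
      Eq (Prod R Nat) (B \<cdot> \<omega> \<cdot> s \<cdot> \<phi> \<cdot> q) (B \<cdot> \<omega>' \<cdot> s \<cdot> \<phi> \<cdot> q'))"
    by simp
  from ImpE[OF ImpE[OF this 1] 2] show ?thesis
    by (rule Eq_cls) (use BR(2) ty in simp_all)
qed

text \<open>Dropping \<open>|s|\<close> entries from \<open>s * x * \<alpha>\<close> leaves
  \<open>cons x \<alpha>\<close>, and \<open>q\<close> there is by definition
  \<open>q\<^sub>x\<close> at \<alpha>, what remains after dropping \<open>|s| + 1\<close> entries.
  So the old and the new control and leaf functionals agree on extensions of \<open>s * x\<close>,
  and locality identifies the recursions.\<close>

lemma epq_shift:
  fixes X R \<Gamma>
  defines "G \<equiv> X # ((Nat \<rightarrowtail> X) \<rightarrowtail> R) # (Seq X \<rightarrowtail> K_ty R X) # Seq X # (R \<rightarrowtail> Nat)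
      # BR_ty (X, Prod R Nat) # \<Gamma>"
    and "s \<equiv> snoc X (Var 3) (Var 0)" and "q \<equiv> sectC X R \<cdot> Var 1 \<cdot> Var 0"
  assumes BR: "BRF X (Prod R Nat) (Var 5) \<in> H"
  shows "cls (G, H) (Var 5 \<cdot> (omegaC X R \<cdot> Var 4 \<cdot> Var 3 \<cdot> Var 1) \<cdot> s \<cdot> (phiC X R \<cdot> Var 2)
      \<cdot> (leafC X R \<cdot> Var 3 \<cdot> Var 1))
    = cls (G, H) (Var 5 \<cdot> (omegaC X R \<cdot> Var 4 \<cdot> s \<cdot> q) \<cdot> s \<cdot> (phiC X R \<cdot> Var 2) \<cdot> (leafC X R \<cdot> s \<cdot> q))"
proof (rule locality_cls)
  show "G | H \<tturnstile> BRF X (Prod R Nat) (Var 5)"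
    using BR by (intro Hyp) (simp_all add: G_def)
  let ?w = "((Nat \<rightarrowtail> X) # G, lift_fm ` H)"
  show "cls ?w (lift 1 (omegaC X R \<cdot> Var 4 \<cdot> Var 3 \<cdot> Var 1) \<cdot> (catC X \<cdot> lift 1 s \<cdot> Var 0))
     = cls ?w (lift 1 (omegaC X R \<cdot> Var 4 \<cdot> s \<cdot> q) \<cdot> (catC X \<cdot> lift 1 s \<cdot> Var 0))"
    by (simp add: G_def s_def q_def omega_app sect_app drop_cat tail_cons)
  show "cls ?w (lift 1 (leafC X R \<cdot> Var 3 \<cdot> Var 1) \<cdot> (catC X \<cdot> lift 1 s \<cdot> Var 0))
     = cls ?w (lift 1 (leafC X R \<cdot> s \<cdot> q) \<cdot> (catC X \<cdot> lift 1 s \<cdot> Var 0))"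
    by (simp add: G_def s_def q_def leaf_app sect_app drop_cat tail_cons)
qed (simp_all add: G_def s_def q_def)

text \<open>First components of the equation of \<open>BR\<close>: since dropping \<open>|s|\<close>
  entries from \<open>s * 0\<close> leaves 0, test and leaf become those of \<open>EPQ\<close>, and
  \<phi> is applied to the first components \<open>?N\<close> of the recursive calls. These have to
  be matched with the calls \<open>?M\<close> that \<open>EPQ\<close> prescribes.\<close>

lemma EPQ_eqn_epqC:
  fixes X R \<Gamma>
  defines "G \<equiv> ((Nat \<rightarrowtail> X) \<rightarrowtail> R) # (Seq X \<rightarrowtail> K_ty R X) # Seq X # (R \<rightarrowtail> Nat) # BR_ty (X, Prod R Nat) # \<Gamma>"
  assumes BR: "BRF X (Prod R Nat) (Var 4) \<in> H"
  shows "G | H \<tturnstile> EPQ_eqn X R (epqC X R \<cdot> Var 4) (Var 3) (Var 2) (Var 1) (Var 0)"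
proof -
  let ?w = "(G, H)"
  let ?q = "sect X (Var 1) (snoc X (Con (NilC X)) (Var 0))"
  let ?M = "Lam X (epqC X R \<cdot> Var 5 \<cdot> Var 4 \<cdot> snoc X (Var 3) (Var 0) \<cdot> Var 2 \<cdot> ?q)"
  let ?N = "fst_compC X R \<cdot> (nextC X (Prod R Nat) \<cdot> Var 4 \<cdot> (omegaC X R \<cdot> Var 3 \<cdot> Var 2 \<cdot> Var 0)
      \<cdot> Var 2 \<cdot> (phiC X R \<cdot> Var 1) \<cdot> (leafC X R \<cdot> Var 2 \<cdot> Var 0))"
  have "cls ?w ?M = cls ?w ?N"
  proof (rule cls_LamI[where U=R])
    let ?w = "(X # G, lift_fm ` H)"
    \<comment> \<open>\<open>sect\<close> is a literal abstraction over the variables; its closed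
      form is what \<open>epq_shift\<close> speaks about.\<close>
    have q: "cls ?w ?q = cls ?w (sectC X R \<cdot> Var 1 \<cdot> Var 0)"
      unfolding sect_def by (rule cls_LamI[where U=R]) (simp_all add: G_def sect_app)
    have "BRF X (Prod R Nat) (Var 5) \<in> lift_fm ` H"
      using imageI[OF BR, of lift_fm] by (simp add: lift_fm_def)
    from epq_shift[OF this] q
    show "cls ?w (epqC X R \<cdot> Var 5 \<cdot> Var 4 \<cdot> snoc X (Var 3) (Var 0) \<cdot> Var 2 \<cdot> ?q)
        = cls ?w (lift (Suc 0) ?N \<cdot> Var 0)"
      by (simp add: G_def epq_app fst_comp_app numeral_eq_Suc)
  qed (simp_all add: G_def sect_def)
  moreover have "G | H \<tturnstile> BRF X (Prod R Nat) (Var 4)"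
    using BR by (intro Hyp) (simp_all add: G_def)
  note BR_rule[OF this, of "cls ?w (omegaC X R \<cdot> Var 3 \<cdot> Var 2 \<cdot> Var 0)" "cls ?w (Var 2)"
      "cls ?w (phiC X R \<cdot> Var 1)"
     "cls ?w (leafC X R \<cdot> Var 2 \<cdot> Var 0)"]
  ultimately have "cls ?w (epqC X R \<cdot> Var 4 \<cdot> Var 3 \<cdot> Var 2 \<cdot> Var 1 \<cdot> Var 0) = cls ?w
    (Con (CondC R) \<cdot> (lessC \<cdot> (Var 3 \<cdot> (Var 0 \<cdot> zero (Nat \<rightarrowtail> X))) \<cdot> (lenC X \<cdot> Var 2))
       \<cdot> (Var 0 \<cdot> zero (Nat \<rightarrowtail> X)) \<cdot> (Var 1 \<cdot> Var 2 \<cdot> ?M))"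
    by (simp add: G_def epq_app omega_app leaf_app phi_app drop_cat fst_cond)
  then have "G | H \<tturnstile> Eq R (epqC X R \<cdot> Var 4 \<cdot> Var 3 \<cdot> Var 2 \<cdot> Var 1 \<cdot> Var 0)
    (Con (CondC R) \<cdot> (lessC \<cdot> (Var 3 \<cdot> (Var 0 \<cdot> zero (Nat \<rightarrowtail> X))) \<cdot> (lenC X \<cdot> Var 2))
       \<cdot> (Var 0 \<cdot> zero (Nat \<rightarrowtail> X)) \<cdot> (Var 1 \<cdot> Var 2 \<cdot> ?M))"
    by (rule EqI_cls) (simp add: G_def)
  then show ?thesis by (simp add: EPQ_eqn_def numeral_eq_Suc)
qed

theorem theorem3p16:
  shows "T_definable (HA_omega \<union> BI) BR EPQ"
  unfolding T_definable_def
proof (intro allI exI conjI)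
  fix p :: "ty \<times> ty"
  obtain X R where p: "p = (X, R)" by (cases p)
  let ?p' = "\<lambda>p :: ty \<times> ty. (fst p, Prod (snd p) Nat)"
    and ?s = "\<lambda>p :: ty \<times> ty. epqC (fst p) (snd p)"
  show "[] \<turnstile> ?s p \<Ztypecolon> (fn_type BR (?p' p) \<rightarrowtail> fn_type EPQ p)"
    by (simp add: p has_type_iff BR_def EPQ_def)
  have "[BR_ty (X, Prod R Nat)] | {BRF X (Prod R Nat) (Var 0)}
      \<tturnstile> fn_eqn EPQ (X, R) (epqC X R \<cdot> Var 0)"
    by (simp add: EPQ_def)
      (intro AllI, simp add: lift_fm_def, rule EPQ_eqn_epqC[simplified], simp add: numeral_eq_Suc)
  then show "prv (HA_omega \<union> BI) [fn_type BR (?p' p)] {fn_eqn BR (?p' p) (Var 0)}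
      (fn_eqn EPQ p (?s p \<cdot> Var 0))"
    by (simp add: p BR_def BRF_def)
qed

end
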